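(* Let $L\ge 1$ be an integer. Let $g_d,g_1,\dots,g_L$ be mutually independent random variables such that $g_d$ is a unit-mean $\kappa$-$\mu$ shadowed power random variable with parameters $(\kappa,\mu,m)$ and, for each $l=1,\dots,L$, $g_l$ is a unit-mean $\kappa$-$\mu$ shadowed power random variable with parameters $(\kappa_l,\mu_l,m_l)$ (all parameters positive reals, not necessarily identical across $l$). Suppose $\mu>0.5$. Put $$\theta_1=\frac{1}{\mu(1+\kappa)},\quad \theta_2=\frac{\mu\kappa+m}{\mu(1+\kappa)m},\quad \theta_{1l}=\frac{1}{\mu_l(1+\kappa_l)},\quad \theta_{2l}=\frac{\mu_l\kappa_l+m_l}{\mu_l(1+\kappa_l)m_l}\quad(1\le l\le L),$$ and $M=\sum_{l=1}^L\mu_l$. Then the interference-limited error vector magnitude $\mathrm{EVM}=\mathbb{E}\left[\sqrt{\left(\sum_{l=1}^L g_l\right)/g_d}\right]$ equals $$\left(\prod_{l=1}^L\theta_{1l}^{m_l-\mu_l}\,\theta_{2l}^{-m_l}\right)\theta_1^{m-\mu}\,\theta_2^{-m}\,\theta_1^{\mu-0.5}\;{}_2F_1\!\left(\mu-0.5,\,m;\,\mu;\,\frac{\mu\kappa}{m+\mu\kappa}\right)\theta_{11}^{M+0.5}\;\frac{\Gamma(\mu-0.5)\,\Gamma(M+0.5)}{\Gamma(\mu)\,\Gamma(M)}$$ $$\times\; F_D^{(2L-1)}\!\left(M+0.5;\ \mu_2-m_2,\dots,\mu_L-m_L,\,m_1,\dots,m_L;\ M;\ 1-\frac{\theta_{1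1}}{\theta_{12}},\dots,1-\frac{\theta_{11}}{\theta_{1L}},\,1-\frac{\theta_{11}}{\theta_{21}},\dots,1-\frac{\theta_{11}}{\theta_{2L}}\right).$$
   Context: Unit-mean $\kappa$-$\mu$ shadowed power random variable with parameters $(\kappa,\mu,m)$, $\kappa,\mu,m>0$: a positive random variable with density $$f(x)=\frac{\theta_1^{m-\mu}x^{\mu-1}}{\theta_2^m\,\Gamma(\mu)}\,e^{-x/\theta_1}\,{}_1F_1\!\left(m;\mu;\frac{(\theta_2-\theta_1)x}{\theta_1\theta_2}\right),\quad x>0,\qquad \theta_1=\frac{1}{\mu(1+\kappa)},\ \theta_2=\frac{\mu\kappa+m}{\mu(1+\kappa)m}.$$ EVM: a desired signal with fading power $g_d$ is received together with $L$ interferers with fading powers $g_1,\dots,g_L$; with unit symbol energy, and in the absence of noise (interference-limited system), the error vector magnitude is $\mathrm{EVM}=\mathbb{E}\left[\sqrt{\left(\sum_{l=1}^L g_l\right)/g_d}\right]$. Special functions: ${}_1F_1$ is Kummer's confluent hypergeometric function and ${}_2F_1$ is the Gauss hypergeometric function. With $(y)_n=\Gamma(y+n)/\Gamma(y)$ the Pochhammer symbol ($(y)_n=y(y+1)\cdots(y+n-1)$, $(y)_0=1$), Lauricella's function of the fourth kind is $$F_D^{(N)}(a;b_1,\dots,b_N;c;x_1,\dots,x_N)=\sum_{i_1,\dots,i_N\ge0}\frac{(a)_{i_1+\cdots+i_N}(b_1)_{i_1}\cdots(b_N)_{i_N}}{(c)_{i_1+\cdots+i_N}\,i_1!\cdots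 i_N!}\,x_1^{i_1}\cdots x_N^{i_N}$$ for $|x_i|<1$, and for general real arguments $x_i<1$ it denotes the (unique) real-analytic continuation of this function to $(-\infty,1)^N$. For $L=1$ the parameter list $\mu_2-m_2,\dots,\mu_L-m_L$ and the corresponding arguments are empty. *)

theory Defs
  imports "HOL-Probability.Probability"
begin

definition hyp1F1 :: "real \<Rightarrow> real \<Rightarrow> real \<Rightarrow> real" where
  "hyp1F1 a c x = eval_fps (fps_hypergeo [a] [c] 1) x"

(* The defining power series; it represents the Gauss function for |x| < 1 only. *)
definition hyp2F1 :: "real \<Rightarrow> real \<Rightarrow> real \<Rightarrow> real \<Rightarrow> real" where
  "hyp2F1 a b c x = eval_fps (fps_hypergeo [a, b] [c] 1) x"

(* Points of R^N and multi-indices in N variables are lists of length N, because the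
   number of variables of the Lauricella function depends on the number of interferers.
   Analyticity on S (which is thereby open in R^N): every point p of S has a polydisc
   inside S on which F is the sum of an unconditionally convergent power series around p. *)
definition real_analytic_tuples :: "nat \<Rightarrow> (real list \<Rightarrow> real) \<Rightarrow> real list set \<Rightarrow> bool" where
  "real_analytic_tuples N F S \<longleftrightarrow>
    (\<forall>p\<in>S. length p = N \<and>
      (\<exists>r>0. \<exists>coef :: nat list \<Rightarrow> real. \<forall>x.
        length x = N \<and> (\<forall>j<N. \<bar>x ! j - p ! j\<bar> < r) \<longrightarrow>
          x \<in> S \<and>
          ((\<lambda>i. coef i * (\<Prod>j<N. (x ! j - p ! j) ^ (i ! j))) has_sum F x) {i. length i = N}))"

definition lauricella_FD_series :: "real \<Rightarrow> real list \<Rightarrow> real \<Rightarrow> real list \<Rightarrow> real" where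
  "lauricella_FD_series a bs c xs =
    (\<Sum>\<^sub>\<infinity>i\<in>{i :: nat list. length i = length bs}.
      pochhammer a (sum_list i) / pochhammer c (sum_list i) *
      (\<Prod>j<length bs. pochhammer (bs ! j) (i ! j) / fact (i ! j) * (xs ! j) ^ (i ! j)))"

(* For length xs = length bs = N and all entries of xs below 1: the value at xs of the
   real-analytic continuation of the series from (-1,1)^N to (-\<infinity>,1)^N. *)
definition lauricella_FD :: "real \<Rightarrow> real list \<Rightarrow> real \<Rightarrow> real list \<Rightarrow> real" where
  "lauricella_FD a bs c xs =
    (THE y. \<exists>F.
      real_analytic_tuples (length bs) F {x. length x = length bs \<and> (\<forall>t\<in>set x. t < 1)} \<and>
      (\<forall>x. length x = length bs \<and> (\<forall>t\<in>set x. \<bar>t\<bar> < 1) \<longrightarrow> F x = lauricella_FD_series a bs c x) \<and>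
      y = F xs)"

definition theta1 :: "real \<Rightarrow> real \<Rightarrow> real" where
  "theta1 \<kappa> \<mu> = 1 / (\<mu> * (1 + \<kappa>))"

definition theta2 :: "real \<Rightarrow> real \<Rightarrow> real \<Rightarrow> real" where
  "theta2 \<kappa> \<mu> m = (\<mu> * \<kappa> + m) / (\<mu> * (1 + \<kappa>) * m)"

definition kms_density :: "real \<Rightarrow> real \<Rightarrow> real \<Rightarrow> real \<Rightarrow> real" where
  "kms_density \<kappa> \<mu> m x =
    (let \<theta>1 = theta1 \<kappa> \<mu>; \<theta>2 = theta2 \<kappa> \<mu> m in
     if x > 0 then
       \<theta>1 powr (m - \<mu>) * x powr (\<mu> - 1) / (\<theta>2 powr m * Gamma \<mu>) * exp (- x / \<theta>1) *
       hyp1F1 m \<mu> ((\<theta>2 - \<theta>1) * x / (\<theta>1 * \<theta>2))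
     else 0)"

(* Unit-mean kappa-mu shadowed power random variable on the probability space P. *)
definition kms_power :: "'a measure \<Rightarrow> real \<Rightarrow> real \<Rightarrow> real \<Rightarrow> ('a \<Rightarrow> real) \<Rightarrow> bool" where
  "kms_power P \<kappa> \<mu> m X \<longleftrightarrow>
    \<kappa> > 0 \<and> \<mu> > 0 \<and> m > 0 \<and> distributed P lborel X (\<lambda>x. ennreal (kms_density \<kappa> \<mu> m x))"

definition evm_ratio :: "nat \<Rightarrow> ('a \<Rightarrow> real) \<Rightarrow> (nat \<Rightarrow> 'a \<Rightarrow> real) \<Rightarrow> 'a \<Rightarrow> real" where
  "evm_ratio L gd g \<omega> = sqrt ((\<Sum>l = 1..L. g l \<omega>) / gd \<omega>)"

(* Error vector magnitude without noise and with unit symbol energy; meaningful when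
   evm_ratio is integrable. *)
definition EVM :: "'a measure \<Rightarrow> nat \<Rightarrow> ('a \<Rightarrow> real) \<Rightarrow> (nat \<Rightarrow> 'a \<Rightarrow> real) \<Rightarrow> real" where
  "EVM P L gd g = (\<integral>\<omega>. evm_ratio L gd g \<omega> \<partial>P)"

end

(* Independence splits the EVM as E[sqrt S] * E[gd^(-1/2)] with S the sum of the interferers.
   The second factor is a termwise Gamma integral of the density. For the first,
   sqrt S = (pi theta)^(-1/2) * integral of s^(-1/2) S e^(-s S/theta) ds over s > 0, theta = theta11;
   by Tonelli this needs only E[S e^(-t S)], minus the derivative of the Laplace transform of S,
   and that transform is an explicit product of powers. After rescaling, E[sqrt S] is a combination
   of integrals of s^(-1/2) (1+s)^(-M-1) prod_j (1 - x_j/(1+s))^(-b_j) ds. As functions of x these are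
   real analytic on x_j < 1 (expand the binomials about any base point), and about 0 the combination
   has exactly the coefficients of F_D. Two continuations agree because both restrict to real
   analytic functions on the segment from 0 to x. *)

theory Submission
  imports Defs "HOL-Complex_Analysis.Cauchy_Integral_Formula" "HOL-Real_Asymp.Real_Asymp"
begin

section \<open>Summation and integration over multi-indices\<close>

text \<open>A direct formula would write S^(1/2) as a multiple of the integral of s^(-3/2) e^(-s S),
  which diverges at s = 0. Splitting off one factor S leaves the negative power S^(-1/2), whose
  Gamma integral converges; the price is a derivative of the Laplace transform. The same obstruction
  appears on the side of F_D: its Euler integral needs a < c, while here a = M + 1/2 and c = M.
  Euler integrals with c + 1 in place of c do converge, and the logarithmic derivative supplies
  exactly the combination of them that lowers the parameter back to c. The exponents \<mu>_l - m_l
  may be negative, so single terms of that combination can be negative. Expectations are therefore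
  kept as nonnegative extended reals, where Tonelli costs nothing, the combination is integrated
  against a finite measure, and the two meet through the nonnegativity of the derivative as a whole.
  The arguments 1 - \<theta>11/\<theta>1l and 1 - \<theta>11/\<theta>2l can lie far below -1,
  outside the cube of the defining series; hence a continuation has to be identified at all.\<close>

lemma has_sum_Times_mult_real:
  fixes f :: "'a \<Rightarrow> real" and g :: "'b \<Rightarrow> real"
  assumes "(f has_sum a) A" "(g has_sum b) B"
  shows "((\<lambda>(x, y). f x * g y) has_sum (a * b)) (A \<times> B)"
proof (rule has_sum_SigmaI)
  show "((\<lambda>y. case (x, y) of (x, y) \<Rightarrow> f x * g y) has_sum f x * b) B" for x
    using has_sum_cmult_right[OF assms(2)] by simp
  show "((\<lambda>x. f x * b) has_sum a * b) A"
    by (rule has_sum_cmult_left[OF assms(1)])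
  obtain s t where s: "((\<lambda>x. norm (f x)) has_sum s) A" and t: "((\<lambda>x. norm (g x)) has_sum t) B"
    using assms[THEN has_sum_imp_summable, THEN summable_on_iff_abs_summable_on_real[THEN iffD1]]
    by (auto simp: summable_on_def)
  \<comment> \<open>Unconditional summability of a real family is absolute, so the product of the
    absolute values is summable too; this is what permits summing the rectangle row by row.\<close>
  have "(\<lambda>(x, y). norm (f x) * norm (g y)) summable_on (A \<times> B)"
  proof (rule summable_on_SigmaI)
    show "((\<lambda>y. case (x, y) of (x, y) \<Rightarrow> norm (f x) * norm (g y)) has_sum norm (f x) * t) B" for x
      using has_sum_cmult_right[OF t] by simp
    show "(\<lambda>x. norm (f x) * t) summable_on A"
      using has_sum_cmult_left[OF s] by (rule has_sum_imp_summable)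
  qed auto
  then have "(\<lambda>x. norm (case x of (x, y) \<Rightarrow> f x * g y)) summable_on (A \<times> B)"
    by (simp add: case_prod_unfold abs_mult)
  then show "(\<lambda>(x, y). f x * g y) summable_on (A \<times> B)"
    by (rule abs_summable_summable)
qed

text \<open>A list of length N + 1 is a head with a tail of length N, so the induction peels off one
  variable as a product of two families. For N = 0 the single empty list carries the empty product
  1.\<close>

lemma has_sum_prod_lists:
  fixes f :: "nat \<Rightarrow> 'a \<Rightarrow> real"
  assumes "\<And>j. j < N \<Longrightarrow> (f j has_sum s j) UNIV"
  shows "((\<lambda>i. \<Prod>j<N. f j (i ! j)) has_sum (\<Prod>j<N. s j)) {i. length i = N}"
  using assms
proof (induction N arbitrary: f s)
  case 0
  then show ?case by (intro has_sum_finiteI) auto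
next
  case (Suc N)
  have "((\<lambda>i. \<Prod>j<N. f (Suc j) (i ! j)) has_sum (\<Prod>j<N. s (Suc j))) {i. length i = N}"
    by (rule Suc.IH) (use Suc.prems in auto)
  from has_sum_Times_mult_real[OF Suc.prems[of 0] this]
  have "((\<lambda>(k, i). f 0 k * (\<Prod>j<N. f (Suc j) (i ! j))) has_sum (\<Prod>j<Suc N. s j))
      (UNIV \<times> {i. length i = N})"
    by (simp add: prod.lessThan_Suc_shift del: prod.lessThan_Suc)
  also have "?this \<longleftrightarrow> ?case"
    by (rule has_sum_reindex_bij_witness[of _ "\<lambda>i. (hd i, tl i)" "\<lambda>(k, i). k # i"])
      (auto simp: length_Suc_conv prod.lessThan_Suc_shift simp del: prod.lessThan_Suc)
  finally show ?case .
qed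

text \<open>A Weierstrass test along the net of finite index sets, with no enumeration of the
  indices: after a finite set \<open>F\<close> the remainder is at most the tail
  \<open>T - sum A F\<close> of the majorant, uniformly in x, so the integrals differ by at most
  this tail times the total mass.\<close>

lemma (in finite_measure) has_sum_lebesgue_integral:
  fixes f :: "'i \<Rightarrow> 'a \<Rightarrow> real"
  assumes f: "\<And>i. i \<in> I \<Longrightarrow> f i \<in> borel_measurable M"
    and g: "g \<in> borel_measurable M"
    and bound: "\<And>i x. i \<in> I \<Longrightarrow> x \<in> space M \<Longrightarrow> \<bar>f i x\<bar> \<le> A i"
    and A: "A summable_on I"
    and sum: "\<And>x. x \<in> space M \<Longrightarrow> ((\<lambda>i. f i x) has_sum g x) I"
  shows "integrable M g" and "((\<lambda>i. \<integral>x. f i x \<partial>M) has_sum (\<integral>x. g x \<partial>M)) I"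
proof -
  define T where "T = infsum A I"
  have T: "(A has_sum T) I" using A by (simp add: T_def)
  have int_f: "integrable M (f i)" if "i \<in> I" for i
    by (rule integrable_const_bound[of _ "A i"]) (use that f bound in auto)
  have rem: "\<bar>g x - (\<Sum>i\<in>F. f i x)\<bar> \<le> T - sum A F"
    if "finite F" "F \<subseteq> I" "x \<in> space M" for F x
  proof -
    have 1: "((\<lambda>i. f i x) has_sum (g x - (\<Sum>i\<in>F. f i x))) (I - F)"
      using that by (intro has_sum_Diff sum has_sum_finite) auto
    have 2: "(A has_sum (T - sum A F)) (I - F)"
      using that by (intro has_sum_Diff T has_sum_finite) auto
    show ?thesis
      using norm_has_sum_bound[OF _ 1, of "T - sum A F"]
        norm_infsum_le[OF 1 2] bound that by auto
  qed
  show int_g: "integrable M g"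
    by (rule integrable_const_bound[of _ T]) (use rem[of "{}"] g in auto)
  have "\<bar>(\<integral>x. g x \<partial>M) - (\<Sum>i\<in>F. \<integral>x. f i x \<partial>M)\<bar> \<le> (T - sum A F) * measure M (space M)"
    if F: "finite F" "F \<subseteq> I" for F
  proof -
    have "(\<integral>x. g x \<partial>M) - (\<Sum>i\<in>F. \<integral>x. f i x \<partial>M) = (\<integral>x. g x - (\<Sum>i\<in>F. f i x) \<partial>M)"
      using F int_f int_g
      by (subst Bochner_Integration.integral_diff, simp, blast, subst Bochner_Integration.integral_sum) auto
    also have "\<bar>\<dots>\<bar> \<le> (\<integral>x. \<bar>g x - (\<Sum>i\<in>F. f i x)\<bar> \<partial>M)"
      by (rule integral_abs_bound)
    also have "\<dots> \<le> (\<integral>x. T - sum A F \<partial>M)"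
      using F int_f int_g rem
      by (intro integral_mono integrable_abs Bochner_Integration.integrable_diff
          Bochner_Integration.integrable_sum) auto
    finally show ?thesis by (simp add: mult.commute)
  qed
  then have ev: "eventually (\<lambda>F. norm ((\<Sum>i\<in>F. \<integral>x. f i x \<partial>M) - (\<integral>x. g x \<partial>M))
      \<le> (T - sum A F) * measure M (space M)) (finite_subsets_at_top I)"
    by (auto simp: eventually_finite_subsets_at_top abs_minus_commute)
  have "((\<lambda>F. (T - sum A F) * measure M (space M)) \<longlongrightarrow> (T - T) * measure M (space M))
      (finite_subsets_at_top I)"
    using T unfolding has_sum_def by (intro tendsto_intros)
  then have "((\<lambda>F. (T - sum A F) * measure M (space M)) \<longlongrightarrow> 0) (finite_subsets_at_top I)"
    by simp
  then have "((\<lambda>F. (\<Sum>i\<in>F. \<integral>x. f i x \<partial>M) - (\<integral>x. g x \<partial>M)) \<longlongrightarrow> 0) (finite_subsets_at_top I)"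
    by (rule Lim_null_comparison[OF ev])
  then show "((\<lambda>i. \<integral>x. f i x \<partial>M) has_sum (\<integral>x. g x \<partial>M)) I"
    unfolding has_sum_def by (subst (asm) Lim_null[symmetric])
qed

section \<open>Binomial series about an arbitrary base point, and Euler integrals\<close>

lemma pochhammer_abs_nonneg: "0 \<le> pochhammer \<bar>b\<bar> k" for b :: real
  by (induction k) (auto simp: pochhammer_Suc)

lemma abs_pochhammer_le: "\<bar>pochhammer b k\<bar> \<le> pochhammer \<bar>b\<bar> k" for b :: real
  by (induction k) (auto simp: pochhammer_Suc abs_mult intro!: mult_mono pochhammer_abs_nonneg)

text \<open>For |b| and |z| the terms are nonnegative and the binomial series still converges. They
  dominate the terms for b and z, so the convergence is absolute and the sum may be taken
  unordered.\<close>

lemma has_sum_binomial_real: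
  fixes b z :: real
  assumes "\<bar>z\<bar> < 1"
  shows "((\<lambda>k. pochhammer b k / fact k * z ^ k) has_sum (1 - z) powr (- b)) UNIV"
proof -
  have sums: "(\<lambda>k. pochhammer b k / fact k * z ^ k) sums (1 - z) powr (- b)"
    if "\<bar>z\<bar> < 1" for b z :: real
    using gen_binomial_real[of "-z" "-b"] that
    by (simp add: gbinomial_pochhammer power_mult_distrib[symmetric] flip: power_minus)
      (simp add: mult.commute mult.left_commute flip: power_mult_distrib)
  have "summable (\<lambda>k. pochhammer \<bar>b\<bar> k / fact k * \<bar>z\<bar> ^ k)"
    using sums[of "\<bar>z\<bar>" "\<bar>b\<bar>"] assms by (auto simp: summable_def)
  then have "summable (\<lambda>k. norm (pochhammer b k / fact k * z ^ k))"
    by (rule summable_comparison_test')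
      (auto simp: abs_mult power_abs intro!: mult_right_mono divide_right_mono abs_pochhammer_le)
  then show ?thesis
    using sums[OF assms] by (rule norm_summable_imp_has_sum)
qed

lemma one_minus_mult_pos:
  fixes u p :: real
  assumes "p < 1" "0 \<le> u" "u \<le> 1"
  shows "0 < 1 - u * p" and "u * (1 - p) \<le> 1 - u * p"
proof -
  show *: "u * (1 - p) \<le> 1 - u * p" using assms by (simp add: algebra_simps)
  show "0 < 1 - u * p"
  proof (cases "u = 0")
    case False
    then have "0 < u * (1 - p)" using assms by auto
    then show ?thesis using * by linarith
  qed simp
qed

text \<open>Write 1 - u x = q (1 - z) with q = 1 - u p and z = u (x - p)/q, and expand in z. Since
  u/q is largest at u = 1, |z| \<le> |x - p|/(1 - p) < 1. The resulting majorant is free of u, so it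
  can be used under an integral over u.\<close>

lemma has_sum_binomial_shift:
  fixes b u p x :: real
  assumes p: "p < 1" and u: "0 \<le> u" "u \<le> 1" and x: "\<bar>x - p\<bar> < 1 - p"
  shows "((\<lambda>k. pochhammer b k / fact k * u ^ k * (1 - u * p) powr (- b - real k) * (x - p) ^ k)
           has_sum (1 - u * x) powr (- b)) UNIV"
    and "\<bar>pochhammer b k / fact k * u ^ k * (1 - u * p) powr (- b - real k) * (x - p) ^ k\<bar>
           \<le> max 1 ((1 - p) powr (- b)) * (pochhammer \<bar>b\<bar> k / fact k * (\<bar>x - p\<bar> / (1 - p)) ^ k)"
proof -
  define q where "q = 1 - u * p"
  define z where "z = u * (x - p) / q"
  have q: "0 < q" "u * (1 - p) \<le> q"
    using one_minus_mult_pos[OF p u] by (auto simp: q_def)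
  have zle: "\<bar>z\<bar> \<le> \<bar>x - p\<bar> / (1 - p)"
  proof -
    have "u / q \<le> 1 / (1 - p)" using q p by (simp add: field_simps)
    then have "u / q * \<bar>x - p\<bar> \<le> 1 / (1 - p) * \<bar>x - p\<bar>" by (rule mult_right_mono) simp
    then show ?thesis using q u by (simp add: z_def abs_mult)
  qed
  also have "\<dots> < 1" using x p by simp
  finally have z1: "\<bar>z\<bar> < 1" .
  have trm: "pochhammer b k / fact k * u ^ k * q powr (- b - real k) * (x - p) ^ k =
      q powr (- b) * (pochhammer b k / fact k * z ^ k)" for k
  proof -
    have "z ^ k = u ^ k * (x - p) ^ k / q ^ k"
      by (simp add: z_def power_mult_distrib power_divide)
    then show ?thesis using q by (simp add: powr_diff powr_realpow)
  qed
  have "q * (1 - z) = 1 - u * x"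
    using q(1) by (simp add: z_def q_def field_simps)
  then have eq: "q powr (- b) * (1 - z) powr (- b) = (1 - u * x) powr (- b)"
    using z1 q by (subst powr_mult[symmetric]) auto
  show "((\<lambda>k. pochhammer b k / fact k * u ^ k * (1 - u * p) powr (- b - real k) * (x - p) ^ k)
           has_sum (1 - u * x) powr (- b)) UNIV"
    using has_sum_cmult_right[OF has_sum_binomial_real[OF z1, of b], of "q powr (- b)"]
    by (simp only: trm eq flip: q_def)
  \<comment> \<open>q lies between 1 and 1 - p, in an order that depends on the sign of p;
    monotonicity of the power then bounds it by its end values, for either sign of b.\<close>
  have qb: "q powr (- b) \<le> max 1 ((1 - p) powr (- b))"
  proof -
    have "min 1 (1 - p) \<le> q \<and> q \<le> max 1 (1 - p)"
    proof (cases "p \<ge> 0")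
      case True
      then have "u * p \<le> 1 * p" "0 \<le> u * p" using u mult_right_mono[of u 1 p] by auto
      then show ?thesis by (auto simp: q_def)
    next
      case False
      then have "1 * p \<le> u * p" "u * p \<le> 0"
        using u mult_right_mono_neg[of u 1 p] by (auto simp: mult_nonneg_nonpos)
      then show ?thesis by (auto simp: q_def)
    qed
    then have "q powr (- b) \<le> max (1 powr (- b)) ((1 - p) powr (- b))"
    proof (cases "b \<ge> 0")
      case True
      have "q powr (- b) \<le> (min 1 (1 - p)) powr (- b)"
        using True p \<open>_ \<and> _\<close> by (intro powr_mono2') auto
      then show ?thesis by (auto simp: min_def split: if_splits)
    next
      case False
      have "q powr (- b) \<le> (max 1 (1 - p)) powr (- b)"
        using False q \<open>_ \<and> _\<close> by (intro powr_mono2) auto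
      then show ?thesis by (auto simp: max_def split: if_splits)
    qed
    then show ?thesis by simp
  qed
  have "\<bar>q powr (- b) * (pochhammer b k / fact k * z ^ k)\<bar> =
      q powr (- b) * (\<bar>pochhammer b k\<bar> / fact k * \<bar>z\<bar> ^ k)"
    by (simp add: abs_mult power_abs)
  also have "\<dots> \<le> max 1 ((1 - p) powr (- b)) * (pochhammer \<bar>b\<bar> k / fact k * (\<bar>x - p\<bar> / (1 - p)) ^ k)"
    by (intro mult_mono qb divide_right_mono abs_pochhammer_le power_mono zle) 
      (auto simp: pochhammer_abs_nonneg)
  finally show "\<bar>pochhammer b k / fact k * u ^ k * (1 - u * p) powr (- b - real k) * (x - p) ^ k\<bar>
           \<le> max 1 ((1 - p) powr (- b)) * (pochhammer \<bar>b\<bar> k / fact k * (\<bar>x - p\<bar> / (1 - p)) ^ k)"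
    by (simp only: trm flip: q_def)
qed

text \<open>The Euler integrand of F_D without its weight. The weight is left to the measure, so
  that the expansions need only a finite measure and values of u in [0, 1].\<close>

definition euler_integral :: "'a measure \<Rightarrow> ('a \<Rightarrow> real) \<Rightarrow> real list \<Rightarrow> real list \<Rightarrow> real" where
  "euler_integral M u bs x = (\<integral>\<omega>. (\<Prod>j<length bs. (1 - u \<omega> * x ! j) powr (- bs ! j)) \<partial>M)"

context finite_measure
begin

text \<open>Every factor is expanded about p_j, the expansions are multiplied over multi-indices,
  and the result is integrated term by term. The coefficients depend on p but not on x, as
  analyticity at p requires.\<close>

lemma has_sum_euler_integral:
  fixes u :: "'a \<Rightarrow> real"
  defines "coef \<equiv> \<lambda>bs p i. \<integral>\<omega>. (\<Prod>j<length bs. pochhammer (bs ! j) (i ! j) / fact (i ! j) *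
      u \<omega> ^ (i ! j) * (1 - u \<omega> * p ! j) powr (- bs ! j - real (i ! j))) \<partial>M"
  assumes u[measurable]: "u \<in> borel_measurable M"
    and u01: "\<And>\<omega>. \<omega> \<in> space M \<Longrightarrow> 0 \<le> u \<omega> \<and> u \<omega> \<le> 1"
    and p: "\<And>j. j < length bs \<Longrightarrow> p ! j < 1"
    and x: "\<And>j. j < length bs \<Longrightarrow> \<bar>x ! j - p ! j\<bar> < 1 - p ! j"
  shows "integrable M (\<lambda>\<omega>. \<Prod>j<length bs. (1 - u \<omega> * x ! j) powr (- bs ! j))"
    and "((\<lambda>i. coef bs p i * (\<Prod>j<length bs. (x ! j - p ! j) ^ (i ! j)))
           has_sum euler_integral M u bs x) {i. length i = length bs}"
proof -
  define t where "t j k \<omega> = pochhammer (bs ! j) k / fact k *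
      u \<omega> ^ k * (1 - u \<omega> * p ! j) powr (- bs ! j - real k) * (x ! j - p ! j) ^ k" for j k \<omega>
  define A where "A j k = max 1 ((1 - p ! j) powr (- bs ! j)) *
      (pochhammer \<bar>bs ! j\<bar> k / fact k * (\<bar>x ! j - p ! j\<bar> / (1 - p ! j)) ^ k)" for j k
  let ?I = "{i. length i = length bs}"
  have t: "((\<lambda>k. t j k \<omega>) has_sum (1 - u \<omega> * x ! j) powr (- bs ! j)) UNIV" "\<bar>t j k \<omega>\<bar> \<le> A j k"
    if "j < length bs" "\<omega> \<in> space M" for j k \<omega>
    using has_sum_binomial_shift[of "p ! j" "u \<omega>" "x ! j" "bs ! j"] u01[OF that(2)] p[OF that(1)] x[OF that(1)]
    by (auto simp: t_def A_def)
  have A: "(A j has_sum max 1 ((1 - p ! j) powr (- bs ! j)) * 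
      (1 - \<bar>x ! j - p ! j\<bar> / (1 - p ! j)) powr (- \<bar>bs ! j\<bar>)) UNIV"
    if "j < length bs" for j
    unfolding A_def
    by (intro has_sum_cmult_right has_sum_binomial_real) (use p[OF that] x[OF that] in \<open>simp add: abs_divide\<close>)
  have meas: "(\<lambda>\<omega>. \<Prod>j<length bs. t j (i ! j) \<omega>) \<in> borel_measurable M" for i
    unfolding t_def by measurable
  have lim: "(\<lambda>\<omega>. \<Prod>j<length bs. (1 - u \<omega> * x ! j) powr (- bs ! j)) \<in> borel_measurable M"
    by measurable
  have bound: "\<bar>\<Prod>j<length bs. t j (i ! j) \<omega>\<bar> \<le> (\<Prod>j<length bs. A j (i ! j))"
    if "\<omega> \<in> space M" for i \<omega>
    unfolding abs_prod by (intro prod_mono) (use t(2) that in auto)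
  have sumA: "(\<lambda>i. \<Prod>j<length bs. A j (i ! j)) summable_on ?I"
    using has_sum_prod_lists[of "length bs" A, OF A] by (rule has_sum_imp_summable)
  have sums: "((\<lambda>i. \<Prod>j<length bs. t j (i ! j) \<omega>) has_sum
      (\<Prod>j<length bs. (1 - u \<omega> * x ! j) powr (- bs ! j))) ?I" if "\<omega> \<in> space M" for \<omega>
    by (rule has_sum_prod_lists[of "length bs" "\<lambda>j k. t j k \<omega>"]) (rule t(1)[OF _ that])
  note L = has_sum_lebesgue_integral[of ?I "\<lambda>i \<omega>. \<Prod>j<length bs. t j (i ! j) \<omega>", OF meas lim bound sumA sums]
  show "integrable M (\<lambda>\<omega>. \<Prod>j<length bs. (1 - u \<omega> * x ! j) powr (- bs ! j))"
    by (rule L(1))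
  have "(\<integral>\<omega>. (\<Prod>j<length bs. t j (i ! j) \<omega>) \<partial>M) =
      coef bs p i * (\<Prod>j<length bs. (x ! j - p ! j) ^ (i ! j))" for i
    unfolding t_def coef_def by (subst prod.distrib) simp
  then show "((\<lambda>i. coef bs p i * (\<Prod>j<length bs. (x ! j - p ! j) ^ (i ! j)))
           has_sum euler_integral M u bs x) ?I"
    using L(2) by (simp add: euler_integral_def)
qed

end

section \<open>Uniqueness of the real-analytic continuation\<close>

text \<open>Multi-indices are grouped by total degree n: each group is finite, and on the line t v
  its monomials share the factor t^n. Unconditional convergence justifies the regrouping.\<close>

lemma sums_along_line:
  fixes coef :: "nat list \<Rightarrow> real"
  assumes "((\<lambda>i. coef i * (\<Prod>j<N. (t * v j) ^ (i ! j))) has_sum s) {i. length i = N}"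
  shows "(\<lambda>n. (\<Sum>i | length i = N \<and> sum_list i = n. coef i * (\<Prod>j<N. v j ^ (i ! j))) * t ^ n) sums s"
proof -
  let ?B = "\<lambda>n. {i :: nat list. length i = N \<and> sum_list i = n}"
  have fin: "finite (?B n)" for n
    by (rule finite_subset[OF _ finite_lists_length_eq[of "{..n :: nat}" N]]) 
      (auto dest: member_le_sum_list)
  have eq: "(\<Prod>j<length i. (t * v j) ^ (i ! j)) = (\<Prod>j<length i. v j ^ (i ! j)) * t ^ sum_list i"
    for i
    by (simp add: power_mult_distrib prod.distrib sum_list_sum_nth atLeast0LessThan flip: power_sum)
  have "((\<lambda>(n, i). coef i * (\<Prod>j<N. v j ^ (i ! j)) * t ^ n) has_sum s) (Sigma UNIV ?B) \<longleftrightarrow>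
    ((\<lambda>i. coef i * (\<Prod>j<N. (t * v j) ^ (i ! j))) has_sum s) {i. length i = N}"
    by (rule has_sum_reindex_bij_witness[of _ "\<lambda>i. (sum_list i, i)" snd]) (auto simp: eq)
  with assms have "((\<lambda>(n, i). coef i * (\<Prod>j<N. v j ^ (i ! j)) * t ^ n) has_sum s) (Sigma UNIV ?B)"
    by simp
  then have "((\<lambda>n. \<Sum>i\<in>?B n. coef i * (\<Prod>j<N. v j ^ (i ! j)) * t ^ n) has_sum s) UNIV"
    by (rule has_sum_SigmaD) (use fin in auto)
  then show ?thesis
    by (intro has_sum_imp_sums) (simp add: sum_distrib_right)
qed

text \<open>Let \<sigma> be the supremum of the points up to which \<open>h\<close> vanishes. The
  series at \<sigma> is zero on a left neighbourhood, so by isolation of zeros all its coefficients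
  vanish; then \<open>h\<close> is zero also beyond \<sigma>, which is impossible if \<sigma> <
  1.\<close>

lemma identity_theorem_unit_interval:
  fixes h :: "real \<Rightarrow> real"
  assumes powser: "\<And>\<tau>. \<tau> \<in> {0..1} \<Longrightarrow>
      \<exists>r>0. \<exists>a. \<forall>t. \<bar>t - \<tau>\<bar> < r \<longrightarrow> (\<lambda>n. a n * (t - \<tau>) ^ n) sums h t"
    and zero: "\<delta> > 0" "\<And>t. 0 \<le> t \<Longrightarrow> t < \<delta> \<Longrightarrow> h t = 0"
  shows "h 1 = 0"
proof -
  define Z where "Z = {t\<in>{0..1}. \<forall>s. 0 \<le> s \<and> s \<le> t \<longrightarrow> h s = 0}"
  define \<sigma> where "\<sigma> = Sup Z"
  have Z: "bdd_above Z" by (auto simp: Z_def)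
  have memZ: "t \<in> Z" if "t \<in> {0..1}" "\<And>s. 0 \<le> s \<Longrightarrow> s \<le> t \<Longrightarrow> h s = 0" for t
    using that by (auto simp: Z_def)
  have "min 1 (\<delta> / 2) \<in> Z" by (rule memZ) (use zero in auto)
  then have "min 1 (\<delta> / 2) \<le> \<sigma>" unfolding \<sigma>_def by (rule cSup_upper) fact
  then have pos: "0 < \<sigma>" using zero(1) by (auto simp: min_def split: if_splits)
  have "\<sigma> \<le> 1" unfolding \<sigma>_def
    by (rule cSup_least, use \<open>min 1 (\<delta> / 2) \<in> Z\<close> in blast, simp add: Z_def)
  have below: "h s = 0" if "0 \<le> s" "s < \<sigma>" for s
  proof -
    have "Z \<noteq> {}" using \<open>min 1 (\<delta> / 2) \<in> Z\<close> by blast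
    from less_cSupD[OF this, of s] that(2) obtain t where t: "t \<in> Z" "s < t"
      unfolding \<sigma>_def by metis
    have "\<forall>s. 0 \<le> s \<and> s \<le> t \<longrightarrow> h s = 0" using t(1) by (simp add: Z_def)
    then show ?thesis using that(1) t(2) by (meson less_imp_le)
  qed
  obtain r a where r: "r > 0" and a: "\<And>t. \<bar>t - \<sigma>\<bar> < r \<Longrightarrow> (\<lambda>n. a n * (t - \<sigma>) ^ n) sums h t"
    using powser[of \<sigma>] pos \<open>\<sigma> \<le> 1\<close> by auto
  \<comment> \<open>The supremum is not known to belong to \<open>Z\<close>, so the value at
    \<sigma> is obtained as a left limit, by continuity of the power series.\<close>
  have "((\<lambda>y. h (\<sigma> + y)) \<longlongrightarrow> a 0) (at 0)"
    by (rule powser_limit_0[OF r, of a]) (use a[of "\<sigma> + _"] in simp)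
  then have "((\<lambda>y. h (\<sigma> + y)) \<longlongrightarrow> a 0) (at_left 0)"
    by (rule filterlim_mono[OF _ order_refl]) (simp add: at_le)
  moreover have "((\<lambda>y. h (\<sigma> + y)) \<longlongrightarrow> 0) (at_left 0)"
  proof (rule tendsto_eventually)
    show "eventually (\<lambda>y. h (\<sigma> + y) = 0) (at_left 0)"
      using eventually_at_left_real[of "- \<sigma>" 0] pos
      by (auto elim!: eventually_mono intro!: below)
  qed
  ultimately have "a 0 = 0" by (intro tendsto_unique[of "at_left (0::real)"]) auto
  have "h \<sigma> = 0" using a[of \<sigma>] r \<open>a 0 = 0\<close> by (simp add: powser_sums_zero_iff)
  have "a m = 0" for m
  proof (rule ccontr)
    assume m: "a m \<noteq> 0"
    then have "m > 0" using \<open>a 0 = 0\<close> by (cases m) auto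
    obtain s where s: "0 < s" "\<And>z. z \<in> cball \<sigma> s - {\<sigma>} \<Longrightarrow> h z \<noteq> 0"
      using powser_0_nonzero[of r \<sigma> a h, OF r _ \<open>h \<sigma> = 0\<close> m \<open>m > 0\<close>] a by auto
    \<comment> \<open>This point lies in [0, \<sigma>) at distance at most s from \<sigma>: it is a
      zero by the choice of \<sigma> and a non-zero by isolation.\<close>
    have "h (max 0 (\<sigma> - s)) = 0" by (rule below) (use pos s in auto)
    moreover have "h (max 0 (\<sigma> - s)) \<noteq> 0" by (rule s(2)) (use pos s in \<open>auto simp: dist_real_def\<close>)
    ultimately show False by simp
  qed
  then have near: "h t = 0" if "\<bar>t - \<sigma>\<bar> < r" for t
    using sums_unique2[OF a[OF that]] by simp
  show "h 1 = 0"
  proof (cases "\<sigma> < 1")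
    case True
    have "h s = 0" if "0 \<le> s" "s \<le> \<sigma> + r / 2" for s
      using that r below[of s] near[of s] by (cases "s < \<sigma>") auto
    then have "min 1 (\<sigma> + r / 2) \<in> Z"
      by (intro memZ) (use pos r in auto)
    then have "min 1 (\<sigma> + r / 2) \<le> \<sigma>" unfolding \<sigma>_def by (rule cSup_upper) fact
    then show ?thesis using True r by (auto simp: min_def split: if_splits)
  next
    case False
    then show ?thesis using \<open>\<sigma> \<le> 1\<close> \<open>h \<sigma> = 0\<close> by simp
  qed
qed

lemma real_analytic_tuples_along_line:
  assumes F: "real_analytic_tuples N F S" and len: "length xs = N"
    and p: "map ((*) \<tau>) xs \<in> S"
  shows "\<exists>r>0. \<exists>a. \<forall>t. \<bar>t - \<tau>\<bar> < r \<longrightarrow> (\<lambda>n. a n * (t - \<tau>) ^ n) sums F (map ((*) t) xs)"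
proof -
  obtain r and coef :: "nat list \<Rightarrow> real" where r: "r > 0" and
    coef: "\<And>x. length x = N \<Longrightarrow> \<forall>j<N. \<bar>x ! j - map ((*) \<tau>) xs ! j\<bar> < r \<Longrightarrow>
      ((\<lambda>i. coef i * (\<Prod>j<N. (x ! j - map ((*) \<tau>) xs ! j) ^ (i ! j))) has_sum F x) {i. length i = N}"
    using F[unfolded real_analytic_tuples_def, rule_format, OF p] by blast
  \<comment> \<open>\<open>B\<close> bounds all coordinates, so |t - \<tau>| < r/B keeps the line
    inside the polydisc; the added 1 keeps \<open>B\<close> positive when \<open>xs\<close> is zero
    or empty.\<close>
  define B where "B = 1 + (\<Sum>j<N. \<bar>xs ! j\<bar>)"
  have "B > 0" unfolding B_def by (intro add_pos_nonneg sum_nonneg) auto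
  have B: "\<bar>xs ! j\<bar> \<le> B" if "j < N" for j
    using member_le_sum[of j "{..<N}" "\<lambda>j. \<bar>xs ! j\<bar>"] that by (simp add: B_def)
  define a where "a n = (\<Sum>i | length i = N \<and> sum_list i = n. coef i * (\<Prod>j<N. (xs ! j) ^ (i ! j)))" for n
  have "(\<lambda>n. a n * (t - \<tau>) ^ n) sums F (map ((*) t) xs)" if t: "\<bar>t - \<tau>\<bar> < r / B" for t
  proof -
    have diff: "map ((*) t) xs ! j - map ((*) \<tau>) xs ! j = (t - \<tau>) * xs ! j" if "j < N" for j
      using that len by (simp add: algebra_simps)
    have "\<bar>(t - \<tau>) * xs ! j\<bar> < r" if "j < N" for j
    proof -
      have "\<bar>(t - \<tau>) * xs ! j\<bar> \<le> \<bar>t - \<tau>\<bar> * B"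
        using B[OF that] by (simp add: abs_mult mult_left_mono)
      also have "\<dots> < r" using t \<open>B > 0\<close> by (simp add: field_simps)
      finally show ?thesis .
    qed
    then have "((\<lambda>i. coef i * (\<Prod>j<N. ((t - \<tau>) * xs ! j) ^ (i ! j))) has_sum F (map ((*) t) xs)) {i. length i = N}"
      using coef[of "map ((*) t) xs"] len diff by simp
    then show ?thesis
      unfolding a_def by (rule sums_along_line)
  qed
  moreover have "r / B > 0" using r \<open>B > 0\<close> by simp
  ultimately show ?thesis by blast
qed

text \<open>The description operator in \<open>lauricella_FD\<close> ranges over values at
  \<open>xs\<close>, not over functions, so two candidates need to be compared at this one point
  only.\<close>

lemma lauricella_FD_eqI:
  assumes F: "real_analytic_tuples (length bs) F {x. length x = length bs \<and> (\<forall>t\<in>set x. t < 1)}"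
    and series: "\<And>x. length x = length bs \<Longrightarrow> \<forall>t\<in>set x. \<bar>t\<bar> < 1 \<Longrightarrow> F x = lauricella_FD_series a bs c x"
    and xs: "length xs = length bs" "\<And>t. t \<in> set xs \<Longrightarrow> t < 1"
  shows "lauricella_FD a bs c xs = F xs"
  unfolding lauricella_FD_def
proof (rule the_equality)
  let ?S = "{x. length x = length bs \<and> (\<forall>t\<in>set x. t < (1 :: real))}"
  show "\<exists>F'. real_analytic_tuples (length bs) F' ?S \<and>
      (\<forall>x. length x = length bs \<and> (\<forall>t\<in>set x. \<bar>t\<bar> < 1) \<longrightarrow> F' x = lauricella_FD_series a bs c x) \<and>
      F xs = F' xs"
    using F series by blast
  fix y
  assume "\<exists>F'. real_analytic_tuples (length bs) F' ?S \<and>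
      (\<forall>x. length x = length bs \<and> (\<forall>t\<in>set x. \<bar>t\<bar> < 1) \<longrightarrow> F' x = lauricella_FD_series a bs c x) \<and>
      y = F' xs"
  then obtain G where G: "real_analytic_tuples (length bs) G ?S"
    "\<And>x. length x = length bs \<Longrightarrow> \<forall>t\<in>set x. \<bar>t\<bar> < 1 \<Longrightarrow> G x = lauricella_FD_series a bs c x"
    and y: "y = G xs" by blast
  \<comment> \<open>The domain is star-shaped about 0: v < 1 gives t v < 1 for t in [0, 1], whatever
    the sign of v.\<close>
  have seg: "map ((*) t) xs \<in> ?S" if "t \<in> {0..1}" for t
  proof -
    have "t * v < 1" if "v < 1" for v
    proof (cases "v \<ge> 0")
      case True
      then have "t * v \<le> 1 * v" using \<open>t \<in> {0..1}\<close> by (intro mult_right_mono) auto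
      then show ?thesis using that by simp
    next
      case False
      then have "t * v \<le> 0" using \<open>t \<in> {0..1}\<close> by (auto intro: mult_nonneg_nonpos)
      then show ?thesis by simp
    qed
    then show ?thesis using xs by auto
  qed
  have "F (map ((*) 1) xs) - G (map ((*) 1) xs) = 0"
  proof (rule identity_theorem_unit_interval[of "\<lambda>t. F (map ((*) t) xs) - G (map ((*) t) xs)"])
    fix \<tau> :: real assume \<tau>: "\<tau> \<in> {0..1}"
    obtain r a where r: "r > 0" "\<And>t. \<bar>t - \<tau>\<bar> < r \<Longrightarrow> (\<lambda>n. a n * (t - \<tau>) ^ n) sums F (map ((*) t) xs)"
      using real_analytic_tuples_along_line[OF F xs(1) seg[OF \<tau>]] by blast
    obtain q b where q: "q > 0" "\<And>t. \<bar>t - \<tau>\<bar> < q \<Longrightarrow> (\<lambda>n. b n * (t - \<tau>) ^ n) sums G (map ((*) t) xs)"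
      using real_analytic_tuples_along_line[OF G(1) xs(1) seg[OF \<tau>]] by blast
    have "(\<lambda>n. (a n - b n) * (t - \<tau>) ^ n) sums (F (map ((*) t) xs) - G (map ((*) t) xs))"
      if "\<bar>t - \<tau>\<bar> < min r q" for t
      using sums_diff[OF r(2) q(2), of t] that by (simp add: algebra_simps)
    then show "\<exists>r>0. \<exists>a. \<forall>t. \<bar>t - \<tau>\<bar> < r \<longrightarrow>
        (\<lambda>n. a n * (t - \<tau>) ^ n) sums (F (map ((*) t) xs) - G (map ((*) t) xs))"
      using r(1) q(1) by (intro exI[of _ "min r q"] conjI exI[of _ "\<lambda>n. a n - b n"]) auto
  next
    \<comment> \<open>For t < 1/\<open>B\<close> all coordinates of the scaled point lie in (-1, 1),
      where both functions equal the defining series.\<close>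
    define B where "B = 1 + sum_list (map abs xs)"
    have "0 \<le> sum_list (map abs xs)" by (rule sum_list_nonneg) auto
    then have "B > 0" by (simp add: B_def)
    then show "1 / B > 0" by simp
    fix t :: real assume t: "0 \<le> t" "t < 1 / B"
    have "\<bar>t * v\<bar> < 1" if "v \<in> set xs" for v
    proof -
      have "\<bar>v\<bar> \<le> B" using member_le_sum_list[of "\<bar>v\<bar>" "map abs xs"] that
        by (fastforce simp: B_def)
      then have "\<bar>t * v\<bar> \<le> t * B" using t by (simp add: abs_mult mult_left_mono)
      also have "\<dots> < 1" using t \<open>B > 0\<close> by (simp add: field_simps)
      finally show ?thesis .
    qed
    then show "F (map ((*) t) xs) - G (map ((*) t) xs) = 0"
      using series[of "map ((*) t) xs"] G(2)[of "map ((*) t) xs"] xs by simp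
  qed
  then show "y = F xs" using y by (simp add: map_idI)
qed

section \<open>Integral representation of the Lauricella function\<close>

lemma nn_integral_powr_exp:
  fixes p q :: real
  assumes q: "q > 0" and p: "p > 0"
  shows "(\<integral>\<^sup>+x. ennreal (indicator {0<..} x * (x powr (q - 1) * exp (- p * x))) \<partial>lborel) =
    ennreal (Gamma q * p powr (- q))" (is "?I = _")
proof -
  have "ennreal (Gamma q) = (\<integral>\<^sup>+t. ennreal (indicator {0..} t * t powr (q - 1) / exp t) \<partial>lborel)"
    by (rule Gamma_conv_nn_integral_real[OF q])
  also have "\<dots> = ennreal p * (\<integral>\<^sup>+t. ennreal (indicator {0..} (p * t) * (p * t) powr (q - 1) / exp (p * t)) \<partial>lborel)"
    using p by (subst nn_integral_real_affine[where c = p and t = 0]) auto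
  also have "(\<integral>\<^sup>+t. ennreal (indicator {0..} (p * t) * (p * t) powr (q - 1) / exp (p * t)) \<partial>lborel) =
      (\<integral>\<^sup>+t. ennreal (p powr (q - 1)) * ennreal (indicator {0<..} t * (t powr (q - 1) * exp (- p * t))) \<partial>lborel)"
    using p by (intro nn_integral_cong)
      (auto simp: powr_mult exp_minus field_simps indicator_def zero_le_mult_iff simp flip: ennreal_mult)
  also have "\<dots> = ennreal (p powr (q - 1)) * ?I"
    by (rule nn_integral_cmult) auto
  finally have "ennreal (p powr (- q)) * ennreal (Gamma q) =
      ennreal (p powr (- q)) * (ennreal p * (ennreal (p powr (q - 1)) * ?I))"
    by simp
  also have "\<dots> = ennreal (p powr (- q) * (p * p powr (q - 1))) * ?I"
    using p by (simp add: ennreal_mult mult.assoc)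
  also have "p powr (- q) * (p * p powr (q - 1)) = 1"
    using p by (simp add: powr_mult_base flip: powr_add)
  finally show ?thesis
    using Gamma_real_pos[OF q] by (simp add: ennreal_mult mult.commute)
qed

text \<open>Both iterated integrals of the kernel \<open>k\<close> are Gamma integrals: x first
  gives \<Gamma>(q) (1 + \<sigma>)^(-q), and \<sigma> first gives \<Gamma>(\<alpha>) x^(-\<alpha>),
  after which \<Gamma>(q - \<alpha>) remains. Tonelli equates them.\<close>

lemma nn_integral_beta_prime:
  fixes \<alpha> q :: real
  assumes \<alpha>: "0 < \<alpha>" "\<alpha> < q"
  shows "(\<integral>\<^sup>+\<sigma>. ennreal (indicator {0<..} \<sigma> * (\<sigma> powr (\<alpha> - 1) * (1 + \<sigma>) powr (- q))) \<partial>lborel) =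
    ennreal (Gamma \<alpha> * Gamma (q - \<alpha>) / Gamma q)" (is "?I = _")
proof -
  define k where "k \<sigma> x = ennreal (indicator {0<..} \<sigma> * \<sigma> powr (\<alpha> - 1) *
     (indicator {0<..} x * (x powr (q - 1) * exp (- (1 + \<sigma>) * x))))" for \<sigma> x :: real
  have q: "0 < q" using \<alpha> by simp
  have G: "Gamma \<alpha> > 0" "Gamma q > 0" "Gamma (q - \<alpha>) > 0"
    using \<alpha> q by (auto intro!: Gamma_real_pos)
  have "(\<integral>\<^sup>+x. k \<sigma> x \<partial>lborel) =
      ennreal (Gamma q) * ennreal (indicator {0<..} \<sigma> * (\<sigma> powr (\<alpha> - 1) * (1 + \<sigma>) powr (- q)))" for \<sigma>
  proof (cases "\<sigma> > 0")
    case True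
    have "(\<integral>\<^sup>+x. k \<sigma> x \<partial>lborel) = ennreal (\<sigma> powr (\<alpha> - 1)) *
       (\<integral>\<^sup>+x. ennreal (indicator {0<..} x * (x powr (q - 1) * exp (- (1 + \<sigma>) * x))) \<partial>lborel)"
      unfolding k_def using True
      by (subst nn_integral_cmult[symmetric]) (auto intro!: nn_integral_cong simp flip: ennreal_mult)
    also have "\<dots> = ennreal (\<sigma> powr (\<alpha> - 1)) * ennreal (Gamma q * (1 + \<sigma>) powr (- q))"
      using True by (subst nn_integral_powr_exp[OF q]) auto
    finally show ?thesis
      using True G by (simp add: mult_ac flip: ennreal_mult)
  qed (simp add: k_def)
  then have "(\<integral>\<^sup>+\<sigma>. \<integral>\<^sup>+x. k \<sigma> x \<partial>lborel \<partial>lborel) = ennreal (Gamma q) * ?I"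
    by (simp add: nn_integral_cmult)
  moreover have "(\<integral>\<^sup>+\<sigma>. k \<sigma> x \<partial>lborel) =
      ennreal (Gamma \<alpha>) * ennreal (indicator {0<..} x * (x powr (q - \<alpha> - 1) * exp (- 1 * x)))" for x
  proof (cases "x > 0")
    case True
    have "(\<integral>\<^sup>+\<sigma>. k \<sigma> x \<partial>lborel) = ennreal (x powr (q - 1) * exp (- x)) *
       (\<integral>\<^sup>+\<sigma>. ennreal (indicator {0<..} \<sigma> * (\<sigma> powr (\<alpha> - 1) * exp (- x * \<sigma>))) \<partial>lborel)"
      unfolding k_def using True
      by (subst nn_integral_cmult[symmetric])
        (auto intro!: nn_integral_cong simp: ring_distribs exp_add exp_diff exp_minus field_simps simp flip: ennreal_mult)
    also have "\<dots> = ennreal (x powr (q - 1) * exp (- x)) * ennreal (Gamma \<alpha> * x powr (- \<alpha>))"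
      by (subst nn_integral_powr_exp[OF \<alpha>(1) True]) auto
    finally show ?thesis
      using True G by (simp add: powr_diff powr_minus powr_add field_simps flip: ennreal_mult)
  qed (simp add: k_def)
  then have "(\<integral>\<^sup>+x. \<integral>\<^sup>+\<sigma>. k \<sigma> x \<partial>lborel \<partial>lborel) = ennreal (Gamma \<alpha>) * ennreal (Gamma (q - \<alpha>))"
    using nn_integral_powr_exp[of "q - \<alpha>" 1] \<alpha> by (simp add: nn_integral_cmult)
  moreover have "(\<integral>\<^sup>+\<sigma>. \<integral>\<^sup>+x. k \<sigma> x \<partial>lborel \<partial>lborel) = (\<integral>\<^sup>+x. \<integral>\<^sup>+\<sigma>. k \<sigma> x \<partial>lborel \<partial>lborel)"
    unfolding k_def by (intro lborel_pair.Fubini') auto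
  ultimately have "ennreal (1 / Gamma q) * (ennreal (Gamma q) * ?I) =
      ennreal (1 / Gamma q) * (ennreal (Gamma \<alpha>) * ennreal (Gamma (q - \<alpha>)))"
    by simp
  also have "ennreal (1 / Gamma q) * (ennreal (Gamma q) * ?I) = ?I"
    using G by (simp add: mult.assoc[symmetric] flip: ennreal_mult)
  finally show ?thesis
    using G by (simp flip: ennreal_mult)
qed

text \<open>The beta prime law with shape parameters \<alpha> and q - \<alpha>, left unnormalised.
  Under u = 1/(1 + \<sigma>) it becomes the Euler weight u^(q - \<alpha> - 1) (1 - u)^(\<alpha> - 1)
  on (0, 1).\<close>

definition beta_prime_measure :: "real \<Rightarrow> real \<Rightarrow> real measure" where
  "beta_prime_measure \<alpha> q = density lborel
     (\<lambda>\<sigma>. ennreal (indicator {0<..} \<sigma> * (\<sigma> powr (\<alpha> - 1) * (1 + \<sigma>) powr (- q))))"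

text \<open>The truncation at \<open>0\<close> keeps the values in \<open>[0, 1]\<close> off the support of the beta prime measure.\<close>

definition inv_succ :: "real \<Rightarrow> real" where
  "inv_succ \<sigma> = 1 / (1 + max 0 \<sigma>)"

lemma inv_succ_measurable [measurable]: "inv_succ \<in> borel_measurable borel"
  unfolding inv_succ_def by measurable

lemma inv_succ_range: "0 \<le> inv_succ \<sigma> \<and> inv_succ \<sigma> \<le> 1"
  by (auto simp: inv_succ_def)

lemma sets_beta_prime_measure [measurable_cong, simp]: "sets (beta_prime_measure \<alpha> q) = sets borel"
  by (simp add: beta_prime_measure_def)

lemma space_beta_prime_measure [simp]: "space (beta_prime_measure \<alpha> q) = UNIV"
  by (simp add: beta_prime_measure_def)

lemma finite_measure_beta_prime:
  assumes "0 < \<alpha>" "\<alpha> < q"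
  shows "finite_measure (beta_prime_measure \<alpha> q)"
proof (rule finite_measureI)
  have "emeasure (beta_prime_measure \<alpha> q) UNIV = ennreal (Gamma \<alpha> * Gamma (q - \<alpha>) / Gamma q)"
    unfolding beta_prime_measure_def nn_integral_beta_prime[OF assms, symmetric]
    by (subst emeasure_density) auto
  then show "emeasure (beta_prime_measure \<alpha> q) (space (beta_prime_measure \<alpha> q)) \<noteq> \<infinity>"
    by simp
qed

text \<open>The factor (1 + \<sigma>)^(-n) turns the density into the one with q + n in place of q,
  so the moment is again a total mass.\<close>

lemma integral_inv_succ_power:
  assumes \<alpha>: "0 < \<alpha>" "\<alpha> < q"
  shows "(\<integral>\<sigma>. inv_succ \<sigma> ^ n \<partial>beta_prime_measure \<alpha> q) = Gamma \<alpha> * Gamma (q - \<alpha> + n) / Gamma (q + n)"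
proof -
  have "(\<integral>\<^sup>+\<sigma>. ennreal (inv_succ \<sigma> ^ n) \<partial>beta_prime_measure \<alpha> q) =
      (\<integral>\<^sup>+\<sigma>. ennreal (indicator {0<..} \<sigma> * (\<sigma> powr (\<alpha> - 1) * (1 + \<sigma>) powr (- (q + n)))) \<partial>lborel)"
    unfolding beta_prime_measure_def
    by (subst nn_integral_density)
      (auto intro!: nn_integral_cong simp: inv_succ_def indicator_def powr_diff powr_realpow power_divide
        simp flip: ennreal_mult)
  also have "\<dots> = ennreal (Gamma \<alpha> * Gamma (q + n - \<alpha>) / Gamma (q + n))"
    using \<alpha> by (intro nn_integral_beta_prime) auto
  also have "q + n - \<alpha> = q - \<alpha> + n" by simp
  finally show ?thesis
    using \<alpha> by (subst integral_eq_nn_integral)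
      (auto simp: inv_succ_range intro!: Gamma_real_pos divide_nonneg_pos mult_nonneg_nonneg less_imp_le)
qed

text \<open>b (b + 1)_k = (b + k) (b)_k at the one entry that is raised. Multiplying by b instead of
  dividing covers b = 0, which occurs when \<mu>_l = m_l.\<close>

lemma prod_list_update_pochhammer:
  fixes bs :: "real list"
  assumes "j < length bs"
  shows "bs ! j * (\<Prod>k<length bs. pochhammer (bs[j := bs ! j + 1] ! k) (i ! k) / fact (i ! k)) =
    (bs ! j + real (i ! j)) * (\<Prod>k<length bs. pochhammer (bs ! k) (i ! k) / fact (i ! k))"
proof -
  have "bs ! j * pochhammer (bs ! j + 1) (i ! j) = (bs ! j + real (i ! j)) * pochhammer (bs ! j) (i ! j)"
    using pochhammer_rec[of "bs ! j" "i ! j"] pochhammer_rec'[of "bs ! j" "i ! j"] by simp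
  moreover have "(\<Prod>k\<in>{..<length bs} - {j}. pochhammer (bs[j := bs ! j + 1] ! k) (i ! k) / fact (i ! k)) =
      (\<Prod>k\<in>{..<length bs} - {j}. pochhammer (bs ! k) (i ! k) / fact (i ! k))"
    by (intro prod.cong) auto
  ultimately have "bs ! j * pochhammer (bs ! j + 1) (i ! j) / fact (i ! j) *
        (\<Prod>k\<in>{..<length bs} - {j}. pochhammer (bs[j := bs ! j + 1] ! k) (i ! k) / fact (i ! k)) =
      (bs ! j + real (i ! j)) * pochhammer (bs ! j) (i ! j) / fact (i ! j) *
        (\<Prod>k\<in>{..<length bs} - {j}. pochhammer (bs ! k) (i ! k) / fact (i ! k))"
    by simp
  then show ?thesis
    using assms by (subst (1 2) prod.remove[of _ j]) (auto simp del: times_divide_eq_left simp: mult.assoc)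
qed

lemma has_sum_sum:
  fixes f :: "'a \<Rightarrow> 'b \<Rightarrow> 'c :: topological_comm_monoid_add"
  assumes "\<And>a. a \<in> A \<Longrightarrow> (f a has_sum s a) B"
  shows "((\<lambda>b. \<Sum>a\<in>A. f a b) has_sum (\<Sum>a\<in>A. s a)) B"
  using assms by (induction A rule: infinite_finite_induct) (auto intro: has_sum_add)

text \<open>
  For \<open>F\<^sub>D(c + 1 - \<alpha>; b; c; x)\<close> the Euler integral with parameter \<open>c\<close> diverges when \<open>\<alpha> \<le> 1\<close>;
  this combination of integrals with \<open>c + 1\<close> in place of \<open>c\<close> is what the integral of minus the
  derivative of \<open>(1 + \<sigma>)\<^bsup>-b\<^sub>0\<^esup> \<Prod>\<^sub>j (1 + \<sigma> - x\<^sub>j)\<^bsup>-b\<^sub>j\<^esup>\<close> against \<open>\<sigma>\<^bsup>\<alpha>-1\<^esup>\<close> produces, where \<open>b\<^sub>0 = c - \<Sum>\<^sub>j b\<^sub>j\<close>.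
\<close>

definition FD_continuation :: "real \<Rightarrow> real list \<Rightarrow> real \<Rightarrow> real list \<Rightarrow> real" where
  "FD_continuation \<alpha> bs c x = Gamma c / (Gamma \<alpha> * Gamma (c + 1 - \<alpha>)) *
    ((c - sum_list bs) * euler_integral (beta_prime_measure \<alpha> (c + 1)) inv_succ bs x +
     (\<Sum>j<length bs. bs ! j *
        euler_integral (beta_prime_measure \<alpha> (c + 1)) inv_succ (bs[j := bs ! j + 1]) x))"

text \<open>The coefficients are kept explicit because they are evaluated at p = 0 when the function
  is compared with the Lauricella series; for analyticity only their independence of x
  matters.\<close>

lemma has_sum_FD_continuation:
  assumes \<alpha>: "0 < \<alpha>" "\<alpha> < c + 1"
    and p: "\<And>j. j < length bs \<Longrightarrow> p ! j < 1"
    and x: "\<And>j. j < length bs \<Longrightarrow> \<bar>x ! j - p ! j\<bar> < 1 - p ! j"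
  defines "coef \<equiv> \<lambda>bs' i. \<integral>\<sigma>. (\<Prod>j<length bs. pochhammer (bs' ! j) (i ! j) / fact (i ! j) *
      inv_succ \<sigma> ^ (i ! j) * (1 - inv_succ \<sigma> * p ! j) powr (- bs' ! j - real (i ! j)))
      \<partial>beta_prime_measure \<alpha> (c + 1)"
  shows "((\<lambda>i. Gamma c / (Gamma \<alpha> * Gamma (c + 1 - \<alpha>)) * ((c - sum_list bs) * coef bs i +
      (\<Sum>j<length bs. bs ! j * coef (bs[j := bs ! j + 1]) i)) *
      (\<Prod>j<length bs. (x ! j - p ! j) ^ (i ! j)))
      has_sum FD_continuation \<alpha> bs c x) {i. length i = length bs}"
proof -
  interpret finite_measure "beta_prime_measure \<alpha> (c + 1)"
    by (rule finite_measure_beta_prime) fact+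
  have *: "((\<lambda>i. coef bs' i * (\<Prod>j<length bs. (x ! j - p ! j) ^ (i ! j)))
           has_sum euler_integral (beta_prime_measure \<alpha> (c + 1)) inv_succ bs' x) {i. length i = length bs}"
    if "length bs' = length bs" for bs'
    using has_sum_euler_integral(2)[of inv_succ bs' p x] p x that inv_succ_range
    by (simp add: coef_def)
  have "((\<lambda>i. Gamma c / (Gamma \<alpha> * Gamma (c + 1 - \<alpha>)) *
      ((c - sum_list bs) * (coef bs i * (\<Prod>j<length bs. (x ! j - p ! j) ^ (i ! j))) +
      (\<Sum>j<length bs. bs ! j * (coef (bs[j := bs ! j + 1]) i * (\<Prod>j<length bs. (x ! j - p ! j) ^ (i ! j))))))
      has_sum FD_continuation \<alpha> bs c x) {i. length i = length bs}"
    unfolding FD_continuation_def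
    by (intro has_sum_cmult_right has_sum_add has_sum_sum *) auto
  then show ?thesis
    by (simp add: algebra_simps sum_distrib_left)
qed

lemma real_analytic_FD_continuation:
  assumes "0 < \<alpha>" "\<alpha> < c + 1"
  shows "real_analytic_tuples (length bs) (FD_continuation \<alpha> bs c)
    {x. length x = length bs \<and> (\<forall>t\<in>set x. t < 1)}"
  unfolding real_analytic_tuples_def
proof (intro ballI conjI)
  fix p assume p: "p \<in> {x. length x = length bs \<and> (\<forall>t\<in>set x. t < (1 :: real))}"
  then show "length p = length bs" by simp
  have p1: "p ! j < 1" if "j < length bs" for j using p that by auto
  \<comment> \<open>Each variable may move by less than 1 - p_j, and r is a common radius. The
    inserted 1 keeps the minimum defined when there are no variables.\<close>
  define r where "r = Min (insert 1 ((\<lambda>j. 1 - p ! j) ` {..<length bs}))"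
  have r: "r > 0" using p1 by (auto simp: r_def)
  have rle: "r \<le> 1 - p ! j" if "j < length bs" for j using that by (auto simp: r_def intro!: Min_le)
  have less1: "t < 1" if x: "length x = length bs" "\<forall>j<length bs. \<bar>x ! j - p ! j\<bar> < r" "t \<in> set x" for x t
  proof -
    obtain j where j: "j < length bs" "t = x ! j" using x by (auto simp: in_set_conv_nth)
    then have "\<bar>x ! j - p ! j\<bar> < r" using x(2) by blast
    then show ?thesis using rle[of j] j by linarith
  qed
  have near: "\<bar>x ! j - p ! j\<bar> < 1 - p ! j"
    if "\<forall>j<length bs. \<bar>x ! j - p ! j\<bar> < r" "j < length bs" for x j
  proof -
    have "\<bar>x ! j - p ! j\<bar> < r" using that by blast
    then show ?thesis using rle[of j] that by linarith
  qed
  \<comment> \<open>The coefficients are found by unification, and the order of the quantifiers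
    forces them to be independent of x.\<close>
  have "\<exists>coef. \<forall>x. (\<forall>j<length bs. \<bar>x ! j - p ! j\<bar> < 1 - p ! j) \<longrightarrow>
      ((\<lambda>i. coef i * (\<Prod>j<length bs. (x ! j - p ! j) ^ (i ! j)))
        has_sum FD_continuation \<alpha> bs c x) {i. length i = length bs}"
    by (rule exI, intro allI impI, rule has_sum_FD_continuation[OF assms p1]) simp_all
  then obtain coef where coef: "\<And>x. \<forall>j<length bs. \<bar>x ! j - p ! j\<bar> < 1 - p ! j \<Longrightarrow>
      ((\<lambda>i. coef i * (\<Prod>j<length bs. (x ! j - p ! j) ^ (i ! j)))
        has_sum FD_continuation \<alpha> bs c x) {i. length i = length bs}"
    by blast
  show "\<exists>r>0. \<exists>coef. \<forall>x. length x = length bs \<and> (\<forall>j<length bs. \<bar>x ! j - p ! j\<bar> < r) \<longrightarrow>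
          x \<in> {x. length x = length bs \<and> (\<forall>t\<in>set x. t < 1)} \<and>
          ((\<lambda>i. coef i * (\<Prod>j<length bs. (x ! j - p ! j) ^ (i ! j)))
            has_sum FD_continuation \<alpha> bs c x) {i. length i = length bs}"
  proof (intro exI[of _ r] exI[of _ coef] conjI r allI impI)
    fix x assume x: "length x = length bs \<and> (\<forall>j<length bs. \<bar>x ! j - p ! j\<bar> < r)"
    then show "x \<in> {x. length x = length bs \<and> (\<forall>t\<in>set x. t < 1)}"
      using less1[of x] by blast
    show "((\<lambda>i. coef i * (\<Prod>j<length bs. (x ! j - p ! j) ^ (i ! j)))
        has_sum FD_continuation \<alpha> bs c x) {i. length i = length bs}"
      by (rule coef) (use near x in blast)
  qed
qed

text \<open>At p = 0 each Euler coefficient is a moment of 1/(1 + \<sigma>) with \<Gamma>(c + 1 + n)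
  in the denominator, n being the total degree. The weights of the combination add up to (c - sum of
  b_j) + (sum of b_j + i_j) = c + n, which reduces \<Gamma>(c + 1 + n) to \<Gamma>(c + n) and so
  produces (c)_n.\<close>

lemma FD_continuation_eq_series:
  assumes \<alpha>: "0 < \<alpha>" "\<alpha> < c + 1" and c: "0 < c"
    and x: "length x = length bs" "\<forall>t\<in>set x. \<bar>t\<bar> < 1"
  shows "FD_continuation \<alpha> bs c x = lauricella_FD_series (c + 1 - \<alpha>) bs c x"
proof -
  let ?p = "replicate (length bs) (0 :: real)" and ?M = "beta_prime_measure \<alpha> (c + 1)"
  let ?P = "\<lambda>i. \<Prod>k<length bs. pochhammer (bs ! k) (i ! k) / fact (i ! k)"
  define coef where "coef bs' i = (\<integral>\<sigma>. (\<Prod>j<length bs. pochhammer (bs' ! j) (i ! j) / fact (i ! j) *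
      inv_succ \<sigma> ^ (i ! j) * (1 - inv_succ \<sigma> * ?p ! j) powr (- bs' ! j - real (i ! j)))
      \<partial>?M)" for bs' and i :: "nat list"
  have coef: "coef bs' i = (\<Prod>j<length bs. pochhammer (bs' ! j) (i ! j) / fact (i ! j)) *
      (Gamma \<alpha> * Gamma (c + 1 - \<alpha> + sum_list i) / Gamma (c + 1 + sum_list i))"
    if "length i = length bs" for bs' i
  proof -
    have "coef bs' i = (\<integral>\<sigma>. (\<Prod>j<length bs. pochhammer (bs' ! j) (i ! j) / fact (i ! j)) *
      inv_succ \<sigma> ^ sum_list i \<partial>?M)"
      unfolding coef_def
    proof (intro Bochner_Integration.integral_cong refl)
      fix \<sigma>
      have "(\<Prod>j<length bs. pochhammer (bs' ! j) (i ! j) / fact (i ! j) *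
          inv_succ \<sigma> ^ (i ! j) * (1 - inv_succ \<sigma> * ?p ! j) powr (- bs' ! j - real (i ! j))) =
        (\<Prod>j<length bs. (pochhammer (bs' ! j) (i ! j) / fact (i ! j)) * inv_succ \<sigma> ^ (i ! j))"
        by (intro prod.cong) auto
      also have "\<dots> = (\<Prod>j<length bs. pochhammer (bs' ! j) (i ! j) / fact (i ! j)) * inv_succ \<sigma> ^ sum_list i"
        using that by (subst prod.distrib) (simp add: sum_list_sum_nth atLeast0LessThan power_sum)
      finally show "(\<Prod>j<length bs. pochhammer (bs' ! j) (i ! j) / fact (i ! j) *
          inv_succ \<sigma> ^ (i ! j) * (1 - inv_succ \<sigma> * ?p ! j) powr (- bs' ! j - real (i ! j))) =
        (\<Prod>j<length bs. pochhammer (bs' ! j) (i ! j) / fact (i ! j)) * inv_succ \<sigma> ^ sum_list i" .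
    qed
    then show ?thesis
      using integral_inv_succ_power[OF \<alpha>, of "sum_list i"] by simp
  qed
  have coefs: "Gamma c / (Gamma \<alpha> * Gamma (c + 1 - \<alpha>)) * ((c - sum_list bs) * coef bs i +
      (\<Sum>j<length bs. bs ! j * coef (bs[j := bs ! j + 1]) i)) =
    pochhammer (c + 1 - \<alpha>) (sum_list i) / pochhammer c (sum_list i) * ?P i"
    if i: "length i = length bs" for i
  proof -
    define n where "n = sum_list i"
    define m where "m = Gamma \<alpha> * Gamma (c + 1 - \<alpha> + n) / Gamma (c + 1 + n)"
    have "(\<Sum>j<length bs. bs ! j * coef (bs[j := bs ! j + 1]) i) =
        (\<Sum>j<length bs. (bs ! j + real (i ! j)) * (?P i * m))"
    proof (intro sum.cong refl)
      fix j assume "j \<in> {..<length bs}"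
      then show "bs ! j * coef (bs[j := bs ! j + 1]) i = (bs ! j + real (i ! j)) * (?P i * m)"
        using prod_list_update_pochhammer[of j bs i]
        by (simp only: coef[OF i] m_def n_def mult.assoc[symmetric] lessThan_iff)
    qed
    also have "\<dots> = (sum_list bs + n) * (?P i * m)"
      using i by (simp add: sum_distrib_right[symmetric] sum.distrib n_def sum_list_sum_nth atLeast0LessThan)
    finally have "(\<Sum>j<length bs. bs ! j * coef (bs[j := bs ! j + 1]) i) = (sum_list bs + n) * (?P i * m)" .
    moreover have "coef bs i = ?P i * m" by (simp only: coef[OF i] m_def n_def)
    ultimately have sum: "(c - sum_list bs) * coef bs i + (\<Sum>j<length bs. bs ! j * coef (bs[j := bs ! j + 1]) i) =
        (c + n) * (?P i * m)"
      by (simp only:) (simp add: ring_distribs)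
    have Gamma_rec: "Gamma (c + 1 + n) = (c + n) * Gamma (c + n)"
      using Gamma_plus1[of "c + n"] c nonpos_Ints_nonpos[of "c + n"] by (auto simp: add_ac)
    have poch: "pochhammer (c + 1 - \<alpha>) n = Gamma (c + 1 - \<alpha> + n) / Gamma (c + 1 - \<alpha>)"
      "pochhammer c n = Gamma (c + n) / Gamma c"
      using \<alpha> c nonpos_Ints_nonpos[of c] nonpos_Ints_nonpos[of "c + 1 - \<alpha>"]
      by (auto intro: pochhammer_Gamma)
    have "Gamma \<alpha> > 0" "Gamma c > 0" "Gamma (c + n) > 0" "Gamma (c + 1 - \<alpha>) > 0" "c + n > 0"
      using \<alpha> c by (auto intro!: Gamma_real_pos)
    then have "Gamma c / (Gamma \<alpha> * Gamma (c + 1 - \<alpha>)) * ((c + n) * (?P i * m)) =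
        pochhammer (c + 1 - \<alpha>) n / pochhammer c n * ?P i"
      unfolding poch m_def Gamma_rec by (simp del: of_nat_sum)
    then show ?thesis
      unfolding sum n_def .
  qed
  have "((\<lambda>i. Gamma c / (Gamma \<alpha> * Gamma (c + 1 - \<alpha>)) * ((c - sum_list bs) * coef bs i +
      (\<Sum>j<length bs. bs ! j * coef (bs[j := bs ! j + 1]) i)) *
      (\<Prod>j<length bs. (x ! j - ?p ! j) ^ (i ! j)))
      has_sum FD_continuation \<alpha> bs c x) {i. length i = length bs}"
    unfolding coef_def by (rule has_sum_FD_continuation[OF \<alpha>]) (use x in auto)
  then have "((\<lambda>i. pochhammer (c + 1 - \<alpha>) (sum_list i) / pochhammer c (sum_list i) * ?P i *
      (\<Prod>j<length bs. (x ! j - ?p ! j) ^ (i ! j)))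
      has_sum FD_continuation \<alpha> bs c x) {i. length i = length bs}"
    by (rule has_sum_cong[THEN iffD1, rotated]) (simp only: coefs mem_Collect_eq)
  then have "((\<lambda>i. pochhammer (c + 1 - \<alpha>) (sum_list i) / pochhammer c (sum_list i) *
      (\<Prod>j<length bs. pochhammer (bs ! j) (i ! j) / fact (i ! j) * (x ! j) ^ (i ! j)))
      has_sum FD_continuation \<alpha> bs c x) {i. length i = length bs}"
    by (subst prod.distrib) (use x in \<open>simp add: mult.assoc\<close>)
  then show ?thesis
    unfolding lauricella_FD_series_def by (simp add: infsumI)
qed

lemma lauricella_FD_eq_continuation:
  assumes "0 < \<alpha>" "\<alpha> < c + 1" "0 < c" "length xs = length bs" "\<And>t. t \<in> set xs \<Longrightarrow> t < 1"
  shows "lauricella_FD (c + 1 - \<alpha>) bs c xs = FD_continuation \<alpha> bs c xs"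
  by (rule lauricella_FD_eqI[OF real_analytic_FD_continuation]) (simp_all add: FD_continuation_eq_series assms)

text \<open>Taking 1 + \<sigma> out of every factor gives \<open>f\<close> = (1 + \<sigma>)^(-(c +
  1)) \<open>g\<close>, where \<open>g\<close> is the integrand behind
  \<open>FD_continuation\<close>: the exponents add up to c and the derivative contributes one more.
  The terms of \<open>g\<close> have no common sign, so they are added as Bochner integrals, and the
  assumed sign of \<open>f\<close> converts the total into a nonnegative integral.\<close>

lemma nn_integral_lauricella_FD:
  fixes bs xs :: "real list"
  assumes \<alpha>: "0 < \<alpha>" "\<alpha> < c + 1" and c: "0 < c"
    and xs: "length xs = length bs" "\<And>t. t \<in> set xs \<Longrightarrow> t < 1"
  defines "f \<equiv> \<lambda>\<sigma>. (1 + \<sigma>) powr (- (c - sum_list bs)) * (\<Prod>j<length bs. (1 + \<sigma> - xs ! j) powr (- bs ! j)) *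
      ((c - sum_list bs) / (1 + \<sigma>) + (\<Sum>j<length bs. bs ! j / (1 + \<sigma> - xs ! j)))"
  assumes nonneg: "\<And>\<sigma>. \<sigma> > 0 \<Longrightarrow> 0 \<le> f \<sigma>"
  shows "(\<integral>\<^sup>+\<sigma>. ennreal (indicator {0<..} \<sigma> * (\<sigma> powr (\<alpha> - 1) * f \<sigma>)) \<partial>lborel) =
    ennreal (Gamma \<alpha> * Gamma (c + 1 - \<alpha>) / Gamma c * lauricella_FD (c + 1 - \<alpha>) bs c xs)"
    and "0 \<le> lauricella_FD (c + 1 - \<alpha>) bs c xs"
proof -
  let ?M = "beta_prime_measure \<alpha> (c + 1)" and ?N = "length bs"
  interpret finite_measure ?M by (rule finite_measure_beta_prime) fact+
  define E where "E bs' \<sigma> = (\<Prod>j<?N. (1 - inv_succ \<sigma> * xs ! j) powr (- bs' ! j))" for bs' \<sigma>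
  have xs1: "xs ! j < 1" if "j < ?N" for j using xs that by auto
  have int_E: "integrable ?M (E bs')" if "length bs' = ?N" for bs'
    using has_sum_euler_integral(1)[of inv_succ bs' xs xs] xs1 inv_succ_range that
    by (simp add: E_def[abs_def])
  define g where "g \<sigma> = (c - sum_list bs) * E bs \<sigma> + (\<Sum>j<?N. bs ! j * E (bs[j := bs ! j + 1]) \<sigma>)" for \<sigma>
  have int_g: "integrable ?M g"
    unfolding g_def[abs_def]
    by (intro Bochner_Integration.integrable_add Bochner_Integration.integrable_sum integrable_mult_right int_E) auto
  have "integral\<^sup>L ?M g = (c - sum_list bs) * integral\<^sup>L ?M (E bs) +
      (\<Sum>j<?N. bs ! j * integral\<^sup>L ?M (E (bs[j := bs ! j + 1])))"
    unfolding g_def[abs_def]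
    by (subst Bochner_Integration.integral_add)
      (auto intro!: Bochner_Integration.integrable_sum integrable_mult_right int_E
        simp: Bochner_Integration.integral_sum int_E)
  also have "\<dots> = Gamma \<alpha> * Gamma (c + 1 - \<alpha>) / Gamma c * FD_continuation \<alpha> bs c xs"
  proof -
    have "Gamma \<alpha> > 0" "Gamma c > 0" "Gamma (c + 1 - \<alpha>) > 0"
      using \<alpha> c by (auto intro!: Gamma_real_pos)
    then show ?thesis
      by (simp add: FD_continuation_def euler_integral_def E_def[abs_def])
  qed
  finally have int: "integral\<^sup>L ?M g = Gamma \<alpha> * Gamma (c + 1 - \<alpha>) / Gamma c * lauricella_FD (c + 1 - \<alpha>) bs c xs"
    by (subst lauricella_FD_eq_continuation) (use \<alpha> c xs in auto)
  have fg: "f \<sigma> = (1 + \<sigma>) powr (- (c + 1)) * g \<sigma>" if \<sigma>: "\<sigma> > 0" for \<sigma>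
  proof -
    define y where "y j = 1 - inv_succ \<sigma> * xs ! j" for j
    have y: "y j > 0" "1 + \<sigma> - xs ! j = (1 + \<sigma>) * y j" if "j < ?N" for j
      using one_minus_mult_pos(1)[OF xs1[OF that], of "inv_succ \<sigma>"] inv_succ_range \<sigma>
      by (auto simp: y_def inv_succ_def field_simps)
    \<comment> \<open>Raising b_j by one divides the integrand by y_j, and y_j (1 + \<sigma>) is the
      denominator 1 + \<sigma> - x_j of the logarithmic derivative.\<close>
    have E_upd: "E (bs[j := bs ! j + 1]) \<sigma> = E bs \<sigma> / y j" if "j < ?N" for j
    proof -
      have "(\<Prod>k\<in>{..<?N} - {j}. y k powr (- bs[j := bs ! j + 1] ! k)) = (\<Prod>k\<in>{..<?N} - {j}. y k powr (- bs ! k))"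
        by (intro prod.cong) auto
      moreover have "y j powr (- (bs ! j + 1)) = y j powr (- bs ! j) / y j"
        using y(1)[OF that] by (simp add: powr_diff flip: powr_minus)
      ultimately show ?thesis
        using that by (simp add: E_def flip: y_def) (subst (1 2) prod.remove[of _ j], auto)
    qed
    have "(\<Prod>j<?N. (1 + \<sigma> - xs ! j) powr (- bs ! j)) = (\<Prod>j<?N. (1 + \<sigma>) powr (- bs ! j) * y j powr (- bs ! j))"
      using y \<sigma> by (intro prod.cong refl) (auto simp: powr_mult)
    also have "\<dots> = (1 + \<sigma>) powr (- sum_list bs) * E bs \<sigma>"
      using \<sigma> by (simp add: prod.distrib E_def y_def sum_list_sum_nth atLeast0LessThan flip: powr_sum sum_negf)
    finally have prod: "(\<Prod>j<?N. (1 + \<sigma> - xs ! j) powr (- bs ! j)) = (1 + \<sigma>) powr (- sum_list bs) * E bs \<sigma>" .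
    have "(\<Sum>j<?N. bs ! j / (1 + \<sigma> - xs ! j)) = (\<Sum>j<?N. bs ! j / y j / (1 + \<sigma>))"
      using y by (intro sum.cong refl) auto
    then have sum: "(\<Sum>j<?N. bs ! j / (1 + \<sigma> - xs ! j)) = (\<Sum>j<?N. bs ! j / y j) / (1 + \<sigma>)"
      by (simp add: sum_divide_distrib)
    have "(\<Sum>j<?N. bs ! j * E (bs[j := bs ! j + 1]) \<sigma>) = (\<Sum>j<?N. E bs \<sigma> * (bs ! j / y j))"
      by (intro sum.cong) (auto simp: E_upd)
    then have "g \<sigma> = E bs \<sigma> * ((c - sum_list bs) + (\<Sum>j<?N. bs ! j / y j))"
      unfolding g_def by (simp add: sum_distrib_left algebra_simps)
    moreover have "(1 + \<sigma>) powr (- (c - sum_list bs)) * (1 + \<sigma>) powr (- sum_list bs) / (1 + \<sigma>) = (1 + \<sigma>) powr (- (c + 1))"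
      using \<sigma> by (simp add: powr_diff powr_minus field_simps flip: powr_add)
    moreover have "f \<sigma> = (1 + \<sigma>) powr (- (c - sum_list bs)) * (1 + \<sigma>) powr (- sum_list bs) / (1 + \<sigma>) *
        (E bs \<sigma> * ((c - sum_list bs) + (\<Sum>j<?N. bs ! j / y j)))"
      unfolding f_def prod sum add_divide_distrib[symmetric] by (simp only: mult_ac times_divide_eq_right)
    ultimately show ?thesis
      by (simp only:)
  qed
  \<comment> \<open>The hypothesis speaks of \<sigma> > 0 only, which is where the density is
    nonzero; hence the claim is almost everywhere for this measure.\<close>
  have g_nonneg: "AE \<sigma> in ?M. 0 \<le> g \<sigma>"
    unfolding beta_prime_measure_def
  proof (subst AE_density, simp, intro AE_I2 impI)
    fix \<sigma> :: real
    assume "0 < ennreal (indicator {0<..} \<sigma> * (\<sigma> powr (\<alpha> - 1) * (1 + \<sigma>) powr (- (c + 1))))"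
    then have "\<sigma> > 0" by (cases "\<sigma> > 0") auto
    then show "0 \<le> g \<sigma>" using nonneg[of \<sigma>] fg[of \<sigma>] by (auto simp: zero_le_mult_iff)
  qed
  have "(\<integral>\<^sup>+\<sigma>. ennreal (indicator {0<..} \<sigma> * (\<sigma> powr (\<alpha> - 1) * f \<sigma>)) \<partial>lborel) = (\<integral>\<^sup>+\<sigma>. ennreal (g \<sigma>) \<partial>?M)"
  proof -
    have "g \<in> borel_measurable ?M" using int_g by blast
    then have [measurable]: "g \<in> borel_measurable borel"
      by (simp cong: measurable_cong_sets)
    have "ennreal (indicator {0<..} \<sigma> * (\<sigma> powr (\<alpha> - 1) * f \<sigma>)) =
        ennreal (indicator {0<..} \<sigma> * (\<sigma> powr (\<alpha> - 1) * (1 + \<sigma>) powr (- (c + 1)))) * ennreal (g \<sigma>)" for \<sigma>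
    proof (cases "\<sigma> > 0")
      case True
      then show ?thesis by (simp only: fg) (simp add: mult.assoc flip: ennreal_mult')
    qed simp
    then show ?thesis
      unfolding beta_prime_measure_def by (subst nn_integral_density) auto
  qed
  also have "\<dots> = ennreal (integral\<^sup>L ?M g)"
    by (rule nn_integral_eq_integral[OF int_g g_nonneg])
  finally show "(\<integral>\<^sup>+\<sigma>. ennreal (indicator {0<..} \<sigma> * (\<sigma> powr (\<alpha> - 1) * f \<sigma>)) \<partial>lborel) =
    ennreal (Gamma \<alpha> * Gamma (c + 1 - \<alpha>) / Gamma c * lauricella_FD (c + 1 - \<alpha>) bs c xs)"
    using int by simp
  have "0 \<le> integral\<^sup>L ?M g" by (rule integral_nonneg_AE[OF g_nonneg])
  moreover have "Gamma \<alpha> * Gamma (c + 1 - \<alpha>) / Gamma c > 0"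
    using \<alpha> c by (intro divide_pos_pos mult_pos_pos Gamma_real_pos) auto
  ultimately show "0 \<le> lauricella_FD (c + 1 - \<alpha>) bs c xs"
    unfolding int by (simp only: zero_le_mult_iff) linarith
qed

section \<open>Moments and Laplace transform of the power variable\<close>

text \<open>The ratio test with the ratio given by a recurrence instead of a quotient, so that
  vanishing terms, as at x = 0, need no separate treatment.\<close>

lemma summable_ratio_tendsto:
  fixes f \<rho> :: "nat \<Rightarrow> real"
  assumes "\<And>n. f (Suc n) = \<rho> n * f n" "\<rho> \<longlonglongrightarrow> L" "\<bar>L\<bar> < 1"
  shows "summable f"
proof -
  obtain d where d: "\<bar>L\<bar> < d" "d < 1" using assms(3) dense by blast
  have "(\<lambda>n. \<bar>\<rho> n\<bar>) \<longlonglongrightarrow> \<bar>L\<bar>" using assms(2) by (intro tendsto_intros)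
  then have "eventually (\<lambda>n. \<bar>\<rho> n\<bar> < d) sequentially" using d(1) by (rule order_tendstoD)
  then obtain N where N: "\<And>n. n \<ge> N \<Longrightarrow> \<bar>\<rho> n\<bar> < d" by (auto simp: eventually_sequentially)
  show ?thesis
  proof (rule summable_ratio_test[OF d(2)])
    fix n assume "n \<ge> N"
    then show "norm (f (Suc n)) \<le> d * norm (f n)"
      using N[of n] by (auto simp: assms(1) abs_mult intro!: mult_right_mono)
  qed
qed

lemma hyp1F1_sums:
  fixes a c x :: real
  assumes c: "c > 0"
  shows "(\<lambda>n. pochhammer a n / (pochhammer c n * fact n) * x ^ n) sums hyp1F1 a c x"
proof -
  let ?f = "\<lambda>n. pochhammer a n / (pochhammer c n * fact n) * x ^ n"
  have "summable ?f"
  proof (rule summable_ratio_tendsto)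
    have "c + real n \<noteq> 0" for n using c by (simp add: add_pos_nonneg less_imp_neq[symmetric])
    then show "?f (Suc n) = ((a + real n) / ((c + real n) * (real n + 1)) * x) * ?f n" for n
      by (simp add: pochhammer_rec' add_ac mult_ac)
    have "(\<lambda>n. (a + real n) / ((c + real n) * (real n + 1))) \<longlonglongrightarrow> 0" by real_asymp
    then show "(\<lambda>n. (a + real n) / ((c + real n) * (real n + 1)) * x) \<longlonglongrightarrow> 0"
      by (rule tendsto_mult_left_zero)
  qed simp
  moreover have "hyp1F1 a c x = (\<Sum>n. ?f n)"
    by (simp add: hyp1F1_def eval_fps_def)
  ultimately show ?thesis by (simp add: summable_sums)
qed

lemma hyp2F1_sums:
  fixes a b c x :: real
  assumes c: "c > 0" and x: "\<bar>x\<bar> < 1"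
  shows "(\<lambda>n. pochhammer a n * pochhammer b n / (pochhammer c n * fact n) * x ^ n) sums hyp2F1 a b c x"
proof -
  let ?f = "\<lambda>n. pochhammer a n * pochhammer b n / (pochhammer c n * fact n) * x ^ n"
  have "summable ?f"
  proof (rule summable_ratio_tendsto)
    have "c + real n \<noteq> 0" for n using c by (simp add: add_pos_nonneg less_imp_neq[symmetric])
    then show "?f (Suc n) = ((a + real n) * (b + real n) / ((c + real n) * (real n + 1)) * x) * ?f n" for n
      by (simp add: pochhammer_rec' add_ac mult_ac)
    have "(\<lambda>n. (a + real n) * (b + real n) / ((c + real n) * (real n + 1))) \<longlonglongrightarrow> 1" by real_asymp
    from tendsto_mult[OF this tendsto_const]
    show "(\<lambda>n. (a + real n) * (b + real n) / ((c + real n) * (real n + 1)) * x) \<longlonglongrightarrow> x"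
      by simp
  qed (use x in simp)
  moreover have "hyp2F1 a b c x = (\<Sum>n. ?f n)"
    by (simp add: hyp2F1_def eval_fps_def)
  ultimately show ?thesis by (simp add: summable_sums)
qed

text \<open>The equal upper and lower parameters cancel and leave a binomial series; this is why the
  Laplace transform of the power variable is elementary.\<close>

lemma hyp2F1_same:
  fixes m \<mu> z :: real
  assumes "\<mu> > 0" "\<bar>z\<bar> < 1"
  shows "hyp2F1 \<mu> m \<mu> z = (1 - z) powr (- m)"
proof -
  have "pochhammer \<mu> n \<noteq> 0" for n using pochhammer_pos[OF assms(1), of n] by simp
  then have "(\<lambda>n. pochhammer m n / fact n * z ^ n) sums hyp2F1 \<mu> m \<mu> z"
    using hyp2F1_sums[OF assms, of \<mu> m] by simp
  moreover have "(\<lambda>n. pochhammer m n / fact n * z ^ n) sums (1 - z) powr (- m)"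
    by (rule has_sum_imp_sums[OF has_sum_binomial_real[OF assms(2)]])
  ultimately show ?thesis by (rule sums_unique2)
qed

text \<open>(\<mu> + 1)_n/(\<mu>)_n = 1 + n/\<mu>, so the series is the binomial series plus 1/\<mu>
  times its image under z d/dz. That image is the series of exponent m + 1 with the index shifted by
  one, its term at n = 0 being zero. It yields the derivative of the Laplace transform without
  differentiating under an integral.\<close>

lemma hyp2F1_plus1:
  fixes m \<mu> z :: real
  assumes "\<mu> > 0" "\<bar>z\<bar> < 1"
  shows "hyp2F1 (\<mu> + 1) m \<mu> z = (1 - z) powr (- m) + m / \<mu> * z * (1 - z) powr (- (m + 1))"
proof -
  let ?b = "\<lambda>m n. pochhammer m n / fact n * z ^ n"
  have b: "?b m sums (1 - z) powr (- m)" for m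
    by (rule has_sum_imp_sums[OF has_sum_binomial_real[OF assms(2)]])
  have "(\<lambda>n. m * z * ?b (m + 1) n) sums (m * z * (1 - z) powr (- (m + 1)))"
    by (intro sums_mult b)
  moreover have "m * z * ?b (m + 1) n = real (Suc n) * ?b m (Suc n)" for n
    by (simp add: pochhammer_rec field_simps del: of_nat_Suc)
  ultimately have "(\<lambda>n. real (Suc n) * ?b m (Suc n)) sums (m * z * (1 - z) powr (- (m + 1)))"
    by (simp only:)
  then have "(\<lambda>n. real n * ?b m n) sums (m * z * (1 - z) powr (- (m + 1)))"
    by (subst (asm) sums_Suc_iff) simp
  then have "(\<lambda>n. ?b m n + 1 / \<mu> * (real n * ?b m n)) sums
      ((1 - z) powr (- m) + 1 / \<mu> * (m * z * (1 - z) powr (- (m + 1))))"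
    by (intro sums_add b sums_mult)
  moreover have "pochhammer (\<mu> + 1) n * pochhammer m n / (pochhammer \<mu> n * fact n) * z ^ n =
      ?b m n + 1 / \<mu> * (real n * ?b m n)" for n
  proof -
    have "pochhammer \<mu> n > 0" using assms(1) by (rule pochhammer_pos)
    moreover have "\<mu> * pochhammer (\<mu> + 1) n = (\<mu> + n) * pochhammer \<mu> n"
      using pochhammer_rec[of \<mu> n] pochhammer_rec'[of \<mu> n] by simp
    then have poch: "pochhammer (\<mu> + 1) n = (\<mu> + n) / \<mu> * pochhammer \<mu> n"
      using assms by (simp add: field_simps)
    ultimately show ?thesis unfolding poch using assms by (simp add: field_simps)
  qed
  ultimately have "(\<lambda>n. pochhammer (\<mu> + 1) n * pochhammer m n / (pochhammer \<mu> n * fact n) * z ^ n) sums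
      ((1 - z) powr (- m) + 1 / \<mu> * (m * z * (1 - z) powr (- (m + 1))))"
    by simp
  from sums_unique2[OF hyp2F1_sums[OF assms, of "\<mu> + 1" m] this] show ?thesis by simp
qed

text \<open>All terms of the Kummer series are nonnegative here, so monotone convergence allows
  termwise Gamma integrals. The factor (q)_n = \<Gamma>(q + n)/\<Gamma>(q) is the second upper
  parameter of the Gauss series, and k < p puts k/p inside its disc.\<close>

lemma nn_integral_powr_exp_hyp1F1:
  fixes q p m \<mu> k :: real
  assumes q: "q > 0" and m: "m > 0" and \<mu>: "\<mu> > 0" and k: "0 \<le> k" "k < p"
  shows "(\<integral>\<^sup>+x. ennreal (indicator {0<..} x * (x powr (q - 1) * exp (- p * x) * hyp1F1 m \<mu> (k * x))) \<partial>lborel) =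
    ennreal (Gamma q * p powr (- q) * hyp2F1 q m \<mu> (k / p))"
proof -
  have p: "p > 0" using k by simp
  define A where "A n = pochhammer m n / (pochhammer \<mu> n * fact n) * k ^ n" for n
  have A: "A n \<ge> 0" for n
    using m \<mu> k by (auto simp: A_def intro!: mult_nonneg_nonneg divide_nonneg_nonneg pochhammer_nonneg)
  have "ennreal (indicator {0<..} x * (x powr (q - 1) * exp (- p * x) * hyp1F1 m \<mu> (k * x))) =
    (\<Sum>n. ennreal (A n) * ennreal (indicator {0<..} x * (x powr (q + real n - 1) * exp (- p * x))))" for x
  proof (cases "x > 0")
    case True
    have "(\<lambda>n. x powr (q - 1) * exp (- p * x) * (pochhammer m n / (pochhammer \<mu> n * fact n) * (k * x) ^ n)) sums
        (x powr (q - 1) * exp (- p * x) * hyp1F1 m \<mu> (k * x))"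
      by (intro sums_mult hyp1F1_sums \<mu>)
    also have "(\<lambda>n. x powr (q - 1) * exp (- p * x) * (pochhammer m n / (pochhammer \<mu> n * fact n) * (k * x) ^ n)) =
        (\<lambda>n. A n * (x powr (q + real n - 1) * exp (- p * x)))"
      using True by (auto simp: A_def fun_eq_iff power_mult_distrib powr_add powr_diff powr_realpow mult_ac)
    finally have "(\<Sum>n. ennreal (A n * (x powr (q + real n - 1) * exp (- p * x)))) =
        ennreal (x powr (q - 1) * exp (- p * x) * hyp1F1 m \<mu> (k * x))"
      using A by (intro suminf_ennreal_eq) auto
    then show ?thesis using True A by (simp add: ennreal_mult)
  qed simp
  then have "(\<integral>\<^sup>+x. ennreal (indicator {0<..} x * (x powr (q - 1) * exp (- p * x) * hyp1F1 m \<mu> (k * x))) \<partial>lborel) =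
    (\<Sum>n. \<integral>\<^sup>+x. ennreal (A n) * ennreal (indicator {0<..} x * (x powr (q + real n - 1) * exp (- p * x))) \<partial>lborel)"
    by (simp add: nn_integral_suminf)
  also have "\<dots> = (\<Sum>n. ennreal (A n * (Gamma (q + n) * p powr (- (q + n)))))"
  proof (rule suminf_cong)
    fix n
    have "(\<integral>\<^sup>+x. ennreal (A n) * ennreal (indicator {0<..} x * (x powr (q + real n - 1) * exp (- p * x))) \<partial>lborel) =
      ennreal (A n) * ennreal (Gamma (q + n) * p powr (- (q + n)))"
      using q p by (subst nn_integral_cmult, simp, subst nn_integral_powr_exp) auto
    then show "(\<integral>\<^sup>+x. ennreal (A n) * ennreal (indicator {0<..} x * (x powr (q + real n - 1) * exp (- p * x))) \<partial>lborel) =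
      ennreal (A n * (Gamma (q + n) * p powr (- (q + n))))"
      using A by (simp add: ennreal_mult')
  qed
  also have "\<dots> = ennreal (Gamma q * p powr (- q) * hyp2F1 q m \<mu> (k / p))"
  proof (rule suminf_ennreal_eq)
    show "0 \<le> A n * (Gamma (q + n) * p powr (- (q + n)))" for n
      using A q by (intro mult_nonneg_nonneg less_imp_le[OF Gamma_real_pos]) auto
    have "A n * (Gamma (q + n) * p powr (- (q + n))) =
      Gamma q * p powr (- q) * (pochhammer q n * pochhammer m n / (pochhammer \<mu> n * fact n) * (k / p) ^ n)" for n
    proof -
      have "Gamma (q + n) = Gamma q * pochhammer q n"
        using q nonpos_Ints_nonpos[of q] Gamma_real_pos[OF q, THEN less_imp_neq] by (subst pochhammer_Gamma) auto
      moreover have "p powr (- (q + n)) = p powr (- q) / p ^ n"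
        using p by (simp add: powr_diff powr_realpow)
      ultimately show ?thesis by (simp add: A_def power_divide)
    qed
    moreover have "(\<lambda>n. Gamma q * p powr (- q) * (pochhammer q n * pochhammer m n / (pochhammer \<mu> n * fact n) * (k / p) ^ n)) sums
       (Gamma q * p powr (- q) * hyp2F1 q m \<mu> (k / p))"
      using k p \<mu> by (intro sums_mult hyp2F1_sums) auto
    ultimately show "(\<lambda>n. A n * (Gamma (q + n) * p powr (- (q + n)))) sums
       (Gamma q * p powr (- q) * hyp2F1 q m \<mu> (k / p))"
      by simp
  qed
  finally show ?thesis .
qed

lemma hyp2F1_nonneg:
  assumes "a > 0" "b > 0" "c > 0" "0 \<le> x" "x < 1"
  shows "0 \<le> hyp2F1 a b c x"
proof (rule sums_le[OF _ sums_zero])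
  show "(\<lambda>n. pochhammer a n * pochhammer b n / (pochhammer c n * fact n) * x ^ n) sums hyp2F1 a b c x"
    using assms by (intro hyp2F1_sums) auto
qed (use assms in \<open>auto intro!: mult_nonneg_nonneg divide_nonneg_nonneg pochhammer_nonneg\<close>)

lemma theta_pos:
  assumes "\<kappa> > 0" "\<mu> > 0" "m > 0"
  shows "theta1 \<kappa> \<mu> > 0" "theta2 \<kappa> \<mu> m > 0" "theta1 \<kappa> \<mu> < theta2 \<kappa> \<mu> m"
  using assms by (auto simp: theta1_def theta2_def field_simps add_pos_pos)

text \<open>One formula serves three expectations: q = \<mu> is the Laplace transform, q = \<mu> + 1
  is minus its derivative, and q = \<mu> - 1/2 with s = 0 is the inverse square root. The density
  vanishes off x > 0, so \<open>h\<close> is prescribed there only and each use can keep its own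
  expression.\<close>

lemma kms_power_moment:
  fixes h :: "real \<Rightarrow> real"
  assumes X: "kms_power P \<kappa> \<mu> m X" and q: "q > 0" and s: "s \<ge> 0"
    and h[measurable]: "h \<in> borel_measurable borel" "\<And>x. x > 0 \<Longrightarrow> h x = x powr (q - \<mu>) * exp (- s * x)"
  defines "\<theta>1 \<equiv> theta1 \<kappa> \<mu>" and "\<theta>2 \<equiv> theta2 \<kappa> \<mu> m"
  shows "(\<integral>\<^sup>+\<omega>. ennreal (h (X \<omega>)) \<partial>P) =
    ennreal (\<theta>1 powr (m - \<mu>) * \<theta>2 powr (- m) * (Gamma q / Gamma \<mu> * (s + 1 / \<theta>1) powr (- q) *
      hyp2F1 q m \<mu> ((1 / \<theta>1 - 1 / \<theta>2) / (s + 1 / \<theta>1))))"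
proof -
  have par: "\<kappa> > 0" "\<mu> > 0" "m > 0" and
    dist: "distributed P lborel X (\<lambda>x. ennreal (kms_density \<kappa> \<mu> m x))"
    using X by (auto simp: kms_power_def)
  note [measurable] = distributed_borel_measurable[OF dist]
  have \<theta>: "\<theta>1 > 0" "\<theta>2 > 0" "\<theta>1 < \<theta>2" using theta_pos[OF par] by (auto simp: \<theta>1_def \<theta>2_def)
  define k where "k = 1 / \<theta>1 - 1 / \<theta>2"
  have k: "0 \<le> k" "k < s + 1 / \<theta>1" 
  proof -
    show "0 \<le> k" using \<theta> by (auto simp: k_def frac_le)
    have "k < 1 / \<theta>1" using \<theta> by (simp add: k_def)
    then show "k < s + 1 / \<theta>1" using s by simp
  qed
  have keq: "(\<theta>2 - \<theta>1) * x / (\<theta>1 * \<theta>2) = k * x" for x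
    using \<theta> by (simp add: k_def field_simps)
  define K where "K = \<theta>1 powr (m - \<mu>) * \<theta>2 powr (- m) / Gamma \<mu>"
  have K: "K \<ge> 0" using Gamma_real_pos[OF par(2)] by (simp add: K_def)
  have eq: "ennreal (kms_density \<kappa> \<mu> m x) * ennreal (h x) = ennreal K *
      ennreal (indicator {0<..} x * (x powr (q - 1) * exp (- (s + 1 / \<theta>1) * x) * hyp1F1 m \<mu> (k * x)))" for x
  proof (cases "x > 0")
    case True
    have h0: "h x \<ge> 0" using True h(2) by simp
    have "kms_density \<kappa> \<mu> m x = \<theta>1 powr (m - \<mu>) * x powr (\<mu> - 1) / (\<theta>2 powr m * Gamma \<mu>) *
        exp (- x / \<theta>1) * hyp1F1 m \<mu> (k * x)"
      using True by (simp add: kms_density_def Let_def keq flip: \<theta>1_def \<theta>2_def)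
    then have "kms_density \<kappa> \<mu> m x * h x =
      K * (x powr (\<mu> - 1) * x powr (q - \<mu>)) * (exp (- x / \<theta>1) * exp (- s * x)) * hyp1F1 m \<mu> (k * x)"
      using True h(2) by (simp add: K_def powr_minus field_simps)
    also have "x powr (\<mu> - 1) * x powr (q - \<mu>) = x powr (q - 1)"
      by (simp flip: powr_add)
    also have "exp (- x / \<theta>1) * exp (- s * x) = exp (- (s + 1 / \<theta>1) * x)"
      by (simp add: algebra_simps flip: exp_add)
    finally show ?thesis
      using True h0 K by (simp add: mult.assoc flip: ennreal_mult' ennreal_mult'')
  qed (simp add: kms_density_def)
  \<comment> \<open>Measurability of the Kummer function is read off from its pointwise power
    series.\<close>
  have hyp_meas: "(\<lambda>x. ennreal (indicator {0<..} x * (x powr (q - 1) * exp (- (s + 1 / \<theta>1) * x) * hyp1F1 m \<mu> (k * x)))) \<in> borel_measurable borel"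
  proof -
    have "hyp1F1 m \<mu> y = (\<Sum>n. pochhammer m n / (pochhammer \<mu> n * fact n) * y ^ n)" for y
      using hyp1F1_sums[OF par(2)] by (rule sums_unique)
    then show ?thesis by simp
  qed
  have "(\<integral>\<^sup>+\<omega>. ennreal (h (X \<omega>)) \<partial>P) = (\<integral>\<^sup>+x. ennreal (kms_density \<kappa> \<mu> m x) * ennreal (h x) \<partial>lborel)"
    by (rule distributed_nn_integral[OF dist, symmetric]) simp
  also have "\<dots> = ennreal K * ennreal (Gamma q * (s + 1 / \<theta>1) powr (- q) * hyp2F1 q m \<mu> (k / (s + 1 / \<theta>1)))"
    unfolding eq
    by (subst nn_integral_cmult) (use hyp_meas nn_integral_powr_exp_hyp1F1[OF q par(3,2) k] in auto)
  also have "\<dots> = ennreal (K * (Gamma q * (s + 1 / \<theta>1) powr (- q) * hyp2F1 q m \<mu> (k / (s + 1 / \<theta>1))))"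
    using K by (simp add: ennreal_mult')
  finally show ?thesis by (simp add: K_def k_def)
qed

text \<open>With p = s + 1/\<theta>1 and r = s + 1/\<theta>2 the argument of the Gauss function is 1
  - r/p, so its powers become powers of r and p. The second formula has the shape of minus the
  derivative: \<phi> times minus its logarithmic derivative.\<close>

lemma kms_power_laplace:
  assumes X: "kms_power P \<kappa> \<mu> m X" and s: "s \<ge> 0"
  defines "\<theta>1 \<equiv> theta1 \<kappa> \<mu>" and "\<theta>2 \<equiv> theta2 \<kappa> \<mu> m"
  defines "\<phi> \<equiv> \<theta>1 powr (m - \<mu>) * \<theta>2 powr (- m) * ((s + 1 / \<theta>1) powr (m - \<mu>) * (s + 1 / \<theta>2) powr (- m))"
  shows "(\<integral>\<^sup>+\<omega>. ennreal (exp (- s * X \<omega>)) \<partial>P) = ennreal \<phi>"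
    and "(\<integral>\<^sup>+\<omega>. ennreal (X \<omega> * exp (- s * X \<omega>)) \<partial>P) =
      ennreal (\<phi> * ((\<mu> - m) / (s + 1 / \<theta>1) + m / (s + 1 / \<theta>2)))"
    and "0 \<le> (\<mu> - m) / (s + 1 / \<theta>1) + m / (s + 1 / \<theta>2)"
proof -
  have par: "\<kappa> > 0" "\<mu> > 0" "m > 0" using X by (auto simp: kms_power_def)
  have \<theta>: "\<theta>1 > 0" "\<theta>2 > 0" "\<theta>1 < \<theta>2" using theta_pos[OF par] by (auto simp: \<theta>1_def \<theta>2_def)
  define p r where "p = s + 1 / \<theta>1" and "r = s + 1 / \<theta>2"
  have pr: "0 < r" "r < p" using \<theta> s by (auto simp: p_def r_def intro!: add_nonneg_pos divide_strict_left_mono)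
  have z: "(1 / \<theta>1 - 1 / \<theta>2) / p = (p - r) / p" by (simp add: p_def r_def)
  have z1: "\<bar>(p - r) / p\<bar> < 1" using pr by simp
  have "1 - (p - r) / p = r / p" using pr by (simp add: field_simps)
  then have pow: "(1 - (p - r) / p) powr (- b) = r powr (- b) * p powr b" for b
    using pr by (simp add: powr_divide powr_minus field_simps)
  have "(\<integral>\<^sup>+\<omega>. ennreal (exp (- s * X \<omega>)) \<partial>P) = ennreal (\<theta>1 powr (m - \<mu>) * \<theta>2 powr (- m) *
      (Gamma \<mu> / Gamma \<mu> * p powr (- \<mu>) * hyp2F1 \<mu> m \<mu> ((p - r) / p)))"
    using kms_power_moment[OF X par(2) s, of "\<lambda>x. exp (- s * x)"]
    by (simp flip: \<theta>1_def \<theta>2_def p_def add: z)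
  also have "Gamma \<mu> / Gamma \<mu> * p powr (- \<mu>) * hyp2F1 \<mu> m \<mu> ((p - r) / p) = p powr (m - \<mu>) * r powr (- m)"
    using pr par Gamma_real_pos[OF par(2), THEN less_imp_neq] unfolding hyp2F1_same[OF par(2) z1] pow
    by (simp add: powr_diff powr_minus field_simps)
  finally show "(\<integral>\<^sup>+\<omega>. ennreal (exp (- s * X \<omega>)) \<partial>P) = ennreal \<phi>"
    by (simp add: \<phi>_def p_def r_def)
  have "(\<integral>\<^sup>+\<omega>. ennreal (X \<omega> * exp (- s * X \<omega>)) \<partial>P) = ennreal (\<theta>1 powr (m - \<mu>) * \<theta>2 powr (- m) *
      (Gamma (\<mu> + 1) / Gamma \<mu> * p powr (- (\<mu> + 1)) * hyp2F1 (\<mu> + 1) m \<mu> ((p - r) / p)))"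
    using kms_power_moment[OF X _ s, of "\<mu> + 1" "\<lambda>x. x * exp (- s * x)"] par
    by (simp flip: \<theta>1_def \<theta>2_def p_def add: z)
  also have "Gamma (\<mu> + 1) / Gamma \<mu> * p powr (- (\<mu> + 1)) * hyp2F1 (\<mu> + 1) m \<mu> ((p - r) / p) =
      p powr (m - \<mu>) * r powr (- m) * ((\<mu> - m) / p + m / r)"
  proof -
    have "Gamma (\<mu> + 1) / Gamma \<mu> = \<mu>"
    proof -
      have "\<mu> \<notin> \<int>\<^sub>\<le>\<^sub>0" using par(2) nonpos_Ints_nonpos[of \<mu>] by auto
      then show ?thesis using Gamma_plus1[of \<mu>] Gamma_real_pos[OF par(2), THEN less_imp_neq] by simp
    qed
    moreover have "p powr (- (\<mu> + 1)) = p powr (- \<mu>) / p"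
      using pr by (simp add: powr_diff)
    moreover have "p powr (m + 1) = p powr m * p" "r powr (- (m + 1)) = r powr (- m) / r"
      using pr by (simp_all add: powr_add powr_diff)
    moreover have "p powr (m - \<mu>) = p powr m * p powr (- \<mu>)"
      by (simp flip: powr_add)
    ultimately show ?thesis
      using pr par by (simp only: hyp2F1_plus1[OF par(2) z1] pow) (simp add: field_simps)
  qed
  finally show "(\<integral>\<^sup>+\<omega>. ennreal (X \<omega> * exp (- s * X \<omega>)) \<partial>P) =
      ennreal (\<phi> * ((\<mu> - m) / (s + 1 / \<theta>1) + m / (s + 1 / \<theta>2)))"
    by (simp add: \<phi>_def p_def r_def mult.assoc)
  \<comment> \<open>\<mu> - m may be negative; regrouping by \<mu> and m leaves two nonnegative
    terms, since \<theta>1 < \<theta>2 makes r < p.\<close>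
  have "0 \<le> \<mu> / p + m * (1 / r - 1 / p)"
    using pr par by (intro add_nonneg_nonneg mult_nonneg_nonneg) (auto simp: frac_le)
  then show "0 \<le> (\<mu> - m) / (s + 1 / \<theta>1) + m / (s + 1 / \<theta>2)"
    by (simp add: p_def r_def diff_divide_distrib right_diff_distrib)
qed

lemma kms_power_measurable: "kms_power P \<kappa> \<mu> m X \<Longrightarrow> X \<in> borel_measurable P"
  by (auto simp: kms_power_def distributed_def)

lemma kms_power_AE_pos:
  assumes "kms_power P \<kappa> \<mu> m X"
  shows "AE \<omega> in P. X \<omega> > 0"
proof -
  have dist: "distributed P lborel X (\<lambda>x. ennreal (kms_density \<kappa> \<mu> m x))"
    using assms by (simp add: kms_power_def)
  have "x > 0" if "0 < ennreal (kms_density \<kappa> \<mu> m x)" for x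
    using that by (cases "x > 0") (auto simp: kms_density_def)
  then have "AE x in density lborel (\<lambda>x. ennreal (kms_density \<kappa> \<mu> m x)). x > 0"
    using distributed_borel_measurable[OF dist] by (subst AE_density) blast+
  then have "AE x in distr P lborel X. x > 0"
    by (simp only: distributed_distr_eq_density[OF dist])
  then show ?thesis
    using distributed_measurable[OF dist] by (subst (asm) AE_distr_iff) auto
qed

section \<open>Square root of a sum of independent power variables\<close>

context prob_space
begin

text \<open>The product rule, performed on expectations: S e^(-s S) is the sum over l of X_l e^(-s
  X_l) times the e^(-s X_k) with k \<noteq> l, and independence factors each summand into all the
  \<open>\<phi> k\<close> and one \<open>d l\<close>. With \<open>Y\<close> valued in
  \<open>ennreal\<close> no integrability has to be checked.\<close>

lemma nn_integral_sum_exp_kms_power: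
  fixes X :: "'i \<Rightarrow> 'a \<Rightarrow> real" and \<kappa> \<mu> m :: "'i \<Rightarrow> real"
  assumes I: "finite I" and indep: "indep_vars (\<lambda>_. borel) X I"
    and X: "\<And>l. l \<in> I \<Longrightarrow> kms_power M (\<kappa> l) (\<mu> l) (m l) (X l)" and s: "s \<ge> 0"
    and \<phi>: "\<And>l. l \<in> I \<Longrightarrow> \<phi> l = theta1 (\<kappa> l) (\<mu> l) powr (m l - \<mu> l) * theta2 (\<kappa> l) (\<mu> l) (m l) powr (- m l) *
      ((s + 1 / theta1 (\<kappa> l) (\<mu> l)) powr (m l - \<mu> l) * (s + 1 / theta2 (\<kappa> l) (\<mu> l) (m l)) powr (- m l))"
    and d: "\<And>l. l \<in> I \<Longrightarrow> d l = (\<mu> l - m l) / (s + 1 / theta1 (\<kappa> l) (\<mu> l)) + m l / (s + 1 / theta2 (\<kappa> l) (\<mu> l) (m l))"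
  shows "(\<integral>\<^sup>+\<omega>. ennreal ((\<Sum>l\<in>I. X l \<omega>) * exp (- s * (\<Sum>l\<in>I. X l \<omega>))) \<partial>M) =
    ennreal (prod \<phi> I * sum d I)"
proof -
  define Y where "Y l k x = ennreal (if k = l then x * exp (- s * x) else exp (- s * x))" for l k :: 'i and x :: real
  have Y_meas [measurable]: "Y l k \<in> borel_measurable borel" for l k
    by (cases "k = l") (simp_all add: Y_def[abs_def])
  have X_meas: "X k \<in> borel_measurable M" if "k \<in> I" for k
    using X[OF that] by (rule kms_power_measurable)
  have \<phi>0: "0 \<le> \<phi> l" if "l \<in> I" for l using \<phi>[OF that] by simp
  have d0: "0 \<le> d l" if "l \<in> I" for l
    using kms_power_laplace(3)[OF X[OF that] s] d[OF that] by simp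
  \<comment> \<open>Positivity, available almost surely only, is what lets \<open>ennreal\<close>
    pass through the sum and the products.\<close>
  have "AE \<omega> in M. \<forall>l\<in>I. X l \<omega> > 0"
    using I X by (intro AE_finite_allI kms_power_AE_pos) auto
  then have "AE \<omega> in M. ennreal ((\<Sum>l\<in>I. X l \<omega>) * exp (- s * (\<Sum>l\<in>I. X l \<omega>))) =
      (\<Sum>l\<in>I. \<Prod>k\<in>I. Y l k (X k \<omega>))"
  proof eventually_elim
    case (elim \<omega>)
    have "(\<Prod>k\<in>I. Y l k (X k \<omega>)) = ennreal (X l \<omega> * exp (- s * (\<Sum>l\<in>I. X l \<omega>)))" if l: "l \<in> I" for l
    proof -
      have "(\<Prod>k\<in>I. Y l k (X k \<omega>)) = ennreal (\<Prod>k\<in>I. if k = l then X k \<omega> * exp (- s * X k \<omega>) else exp (- s * X k \<omega>))"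
        unfolding Y_def using elim by (intro prod_ennreal) (auto intro: less_imp_le)
      also have "(\<Prod>k\<in>I. if k = l then X k \<omega> * exp (- s * X k \<omega>) else exp (- s * X k \<omega>)) =
          X l \<omega> * (\<Prod>k\<in>I. exp (- s * X k \<omega>))"
      proof -
        have "(\<Prod>k\<in>I. if k = l then X k \<omega> * exp (- s * X k \<omega>) else exp (- s * X k \<omega>)) =
            (\<Prod>k\<in>I. (if k = l then X k \<omega> else 1) * exp (- s * X k \<omega>))"
          by (intro prod.cong) auto
        then show ?thesis using I l by (simp add: prod.distrib prod.delta)
      qed
      also have "(\<Prod>k\<in>I. exp (- s * X k \<omega>)) = exp (- s * (\<Sum>l\<in>I. X l \<omega>))"
        using I by (simp add: exp_sum[symmetric] sum_distrib_left)
      finally show ?thesis .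
    qed
    then have "(\<Sum>l\<in>I. \<Prod>k\<in>I. Y l k (X k \<omega>)) = (\<Sum>l\<in>I. ennreal (X l \<omega> * exp (- s * (\<Sum>l\<in>I. X l \<omega>))))"
      by simp
    also have "\<dots> = ennreal (\<Sum>l\<in>I. X l \<omega> * exp (- s * (\<Sum>l\<in>I. X l \<omega>)))"
      using elim by (intro sum_ennreal) (auto intro: less_imp_le)
    finally show ?case by (simp add: sum_distrib_right)
  qed
  then have "(\<integral>\<^sup>+\<omega>. ennreal ((\<Sum>l\<in>I. X l \<omega>) * exp (- s * (\<Sum>l\<in>I. X l \<omega>))) \<partial>M) =
      (\<integral>\<^sup>+\<omega>. (\<Sum>l\<in>I. \<Prod>k\<in>I. Y l k (X k \<omega>)) \<partial>M)"
    by (rule nn_integral_cong_AE)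
  also have "\<dots> = (\<Sum>l\<in>I. \<integral>\<^sup>+\<omega>. (\<Prod>k\<in>I. Y l k (X k \<omega>)) \<partial>M)"
    by (intro nn_integral_sum borel_measurable_prod_ennreal measurable_compose[OF X_meas Y_meas])
  also have "\<dots> = (\<Sum>l\<in>I. ennreal (prod \<phi> I * d l))"
  proof (intro sum.cong refl)
    fix l assume l: "l \<in> I"
    have "(\<integral>\<^sup>+\<omega>. (\<Prod>k\<in>I. Y l k (X k \<omega>)) \<partial>M) = (\<Prod>k\<in>I. \<integral>\<^sup>+\<omega>. Y l k (X k \<omega>) \<partial>M)"
      by (intro indep_vars_nn_integral I indep_vars_compose2[OF indep]) auto
    also have "\<dots> = (\<Prod>k\<in>I. ennreal (\<phi> k * (if k = l then d k else 1)))"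
      using kms_power_laplace(1,2)[OF X s] \<phi> d l by (intro prod.cong refl) (simp add: Y_def)
    also have "\<dots> = ennreal (\<Prod>k\<in>I. \<phi> k * (if k = l then d k else 1))"
      using \<phi>0 d0 by (intro prod_ennreal) auto
    also have "(\<Prod>k\<in>I. \<phi> k * (if k = l then d k else 1)) = prod \<phi> I * d l"
      using I l by (simp add: prod.distrib prod.delta)
    finally show "(\<integral>\<^sup>+\<omega>. (\<Prod>k\<in>I. Y l k (X k \<omega>)) \<partial>M) = ennreal (prod \<phi> I * d l)" .
  qed
  also have "\<dots> = ennreal (\<Sum>l\<in>I. prod \<phi> I * d l)"
    using \<phi>0 d0 by (intro sum_ennreal mult_nonneg_nonneg prod_nonneg) auto
  finally show ?thesis by (simp add: sum_distrib_left)
qed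

text \<open>At rate S/\<theta> the Gamma integral is \<Gamma>(1/2) (S/\<theta>)^(-1/2) with
  \<Gamma>(1/2) = sqrt pi. The constant stays on the left to avoid division in
  \<open>ennreal\<close>. Where S = 0 both sides vanish, though the Gamma formula itself needs a
  positive rate.\<close>

lemma nn_integral_sqrt_via_exp:
  fixes S :: "'a \<Rightarrow> real"
  assumes S[measurable]: "S \<in> borel_measurable M" and S0: "AE \<omega> in M. 0 \<le> S \<omega>" and \<theta>: "\<theta> > 0"
  shows "ennreal (sqrt (pi * \<theta>)) * (\<integral>\<^sup>+\<omega>. ennreal (sqrt (S \<omega>)) \<partial>M) =
    (\<integral>\<^sup>+\<sigma>. ennreal (indicator {0<..} \<sigma> * \<sigma> powr (1 / 2 - 1)) *
       (\<integral>\<^sup>+\<omega>. ennreal (S \<omega> * exp (- (\<sigma> / \<theta>) * S \<omega>)) \<partial>M) \<partial>lborel)"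
proof -
  interpret pair_sigma_finite lborel M ..
  have "(\<integral>\<^sup>+\<sigma>. ennreal (indicator {0<..} \<sigma> * \<sigma> powr (1 / 2 - 1)) * ennreal (S \<omega> * exp (- (\<sigma> / \<theta>) * S \<omega>)) \<partial>lborel) =
      ennreal (sqrt (pi * \<theta>)) * ennreal (sqrt (S \<omega>))" if "0 \<le> S \<omega>" for \<omega>
  proof (cases "S \<omega> = 0")
    case False
    then have pos: "S \<omega> > 0" using that by simp
    have "(\<integral>\<^sup>+\<sigma>. ennreal (indicator {0<..} \<sigma> * \<sigma> powr (1 / 2 - 1)) * ennreal (S \<omega> * exp (- (\<sigma> / \<theta>) * S \<omega>)) \<partial>lborel) =
      (\<integral>\<^sup>+\<sigma>. ennreal (S \<omega>) * ennreal (indicator {0<..} \<sigma> * (\<sigma> powr (1 / 2 - 1) * exp (- (S \<omega> / \<theta>) * \<sigma>))) \<partial>lborel)"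
      using pos by (intro nn_integral_cong) (simp add: mult_ac flip: ennreal_mult)
    also have "\<dots> = ennreal (S \<omega>) * ennreal (Gamma (1 / 2) * (S \<omega> / \<theta>) powr (- (1 / 2)))"
      using pos \<theta> by (subst nn_integral_cmult, simp, subst nn_integral_powr_exp) auto
    also have "\<dots> = ennreal (S \<omega> * (Gamma (1 / 2) * (S \<omega> / \<theta>) powr (- (1 / 2))))"
      using pos by (simp add: ennreal_mult')
    also have "S \<omega> * (Gamma (1 / 2) * (S \<omega> / \<theta>) powr (- (1 / 2))) = sqrt (pi * \<theta>) * sqrt (S \<omega>)"
    proof -
      have "S \<omega> / sqrt (S \<omega>) = sqrt (S \<omega>)" using pos by (simp add: real_div_sqrt)
      then show ?thesis using pos \<theta>
        by (simp add: powr_minus powr_half_sqrt real_sqrt_divide real_sqrt_mult Gamma_one_half_real field_simps)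
    qed
    finally show ?thesis using \<theta> that by (simp add: ennreal_mult)
  qed simp
  with S0 have "(\<integral>\<^sup>+\<omega>. ennreal (sqrt (pi * \<theta>)) * ennreal (sqrt (S \<omega>)) \<partial>M) =
    (\<integral>\<^sup>+\<omega>. \<integral>\<^sup>+\<sigma>. ennreal (indicator {0<..} \<sigma> * \<sigma> powr (1 / 2 - 1)) * ennreal (S \<omega> * exp (- (\<sigma> / \<theta>) * S \<omega>)) \<partial>lborel \<partial>M)"
    by (intro nn_integral_cong_AE) (auto elim!: eventually_mono)
  also have "\<dots> = (\<integral>\<^sup>+\<sigma>. \<integral>\<^sup>+\<omega>. ennreal (indicator {0<..} \<sigma> * \<sigma> powr (1 / 2 - 1)) * ennreal (S \<omega> * exp (- (\<sigma> / \<theta>) * S \<omega>)) \<partial>M \<partial>lborel)"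
    by (rule Fubini') measurable
  finally show ?thesis
    by (simp add: nn_integral_cmult)
qed

end

section \<open>From the interferer parameters to the parameter lists of F_D\<close>

lemma prod_nth_conv_prod_list:
  fixes h :: "'a \<Rightarrow> 'b \<Rightarrow> 'c :: comm_monoid_mult"
  assumes "length xs = length ys"
  shows "(\<Prod>j<length xs. h (xs ! j) (ys ! j)) = prod_list (map2 h xs ys)"
  using assms by (simp add: prod.list_conv_set_nth atLeast0LessThan)

lemma sum_nth_conv_sum_list:
  fixes h :: "'a \<Rightarrow> 'b \<Rightarrow> 'c :: comm_monoid_add"
  assumes "length xs = length ys"
  shows "(\<Sum>j<length xs. h (xs ! j) (ys ! j)) = sum_list (map2 h xs ys)"
  using assms by (simp add: sum.list_conv_set_nth atLeast0LessThan)

lemma map2_map: "map2 h (map f xs) (map g xs) = map (\<lambda>x. h (f x) (g x)) xs"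
  by (induction xs) auto

text \<open>
  The lists contain no entry for the factor with \<open>\<theta>1 1\<close>: after the rescaling by \<open>\<theta>1 1\<close> it is
  the power of \<open>1 + \<sigma>\<close> with the complementary exponent \<open>\<mu> 1 - m 1 = c - sum_list bs\<close>.
\<close>

lemma interferer_lists_prod_sum:
  fixes \<mu> m \<theta>1 \<theta>2 :: "nat \<Rightarrow> real" and L :: nat
  assumes L: "L \<ge> 1"
  defines "\<theta> \<equiv> \<theta>1 1" and "c \<equiv> \<Sum>l = 1..L. \<mu> l"
  defines "bs \<equiv> map (\<lambda>l. \<mu> l - m l) [2..<L+1] @ map m [1..<L+1]"
    and "xs \<equiv> map (\<lambda>l. 1 - \<theta> / \<theta>1 l) [2..<L+1] @ map (\<lambda>l. 1 - \<theta> / \<theta>2 l) [1..<L+1]"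
  assumes \<theta>: "\<And>l. l \<in> {1..L} \<Longrightarrow> \<theta>1 l > 0 \<and> \<theta>2 l > 0"
    and \<sigma>: "\<sigma> > 0"
  shows "(1 + \<sigma>) powr (- (c - sum_list bs)) * (\<Prod>j<length bs. (1 + \<sigma> - xs ! j) powr (- bs ! j)) =
      (\<Prod>l = 1..L. (\<sigma> + \<theta> / \<theta>1 l) powr (m l - \<mu> l) * (\<sigma> + \<theta> / \<theta>2 l) powr (- m l))"
    and "(c - sum_list bs) / (1 + \<sigma>) + (\<Sum>j<length bs. bs ! j / (1 + \<sigma> - xs ! j)) =
      (\<Sum>l = 1..L. (\<mu> l - m l) / (\<sigma> + \<theta> / \<theta>1 l) + m l / (\<sigma> + \<theta> / \<theta>2 l))"
proof -
  have len: "length bs = length xs" by (simp add: bs_def xs_def)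
  have set1: "{Suc 0..L} = insert (Suc 0) {2..L}" using L by auto
  have set2: "set [2..<L+1] = {2..L}" "set [1..<L+1] = {1..L}" by auto
  have "sum_list bs = (\<Sum>l = 2..L. \<mu> l - m l) + (\<Sum>l = 1..L. m l)"
    unfolding bs_def set2[symmetric] by (simp add: sum.distinct_set_conv_list del: upt_Suc set_upt)
  then have c: "c - sum_list bs = \<mu> 1 - m 1"
    by (simp add: c_def set1 sum_subtractf)
  have one: "\<theta> / \<theta>1 (Suc 0) = 1" using \<theta>[of 1] L by (simp add: \<theta>_def)
  \<comment> \<open>An entry x = 1 - \<theta>/t turns 1 + \<sigma> - x into \<sigma> +
    \<theta>/t.\<close>
  have "(\<Prod>j<length bs. (1 + \<sigma> - xs ! j) powr (- bs ! j)) =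
      (\<Prod>l = 2..L. (\<sigma> + \<theta> / \<theta>1 l) powr (m l - \<mu> l)) * (\<Prod>l = 1..L. (\<sigma> + \<theta> / \<theta>2 l) powr (- m l))"
    unfolding prod_nth_conv_prod_list[OF len, of "\<lambda>b x. (1 + \<sigma> - x) powr (- b)"]
    unfolding bs_def xs_def set2[symmetric]
    by (simp add: prod.distinct_set_conv_list map2_map del: upt_Suc set_upt)
  then show "(1 + \<sigma>) powr (- (c - sum_list bs)) * (\<Prod>j<length bs. (1 + \<sigma> - xs ! j) powr (- bs ! j)) =
      (\<Prod>l = 1..L. (\<sigma> + \<theta> / \<theta>1 l) powr (m l - \<mu> l) * (\<sigma> + \<theta> / \<theta>2 l) powr (- m l))"
    unfolding c prod.distrib by (simp add: set1 one add.commute mult.assoc)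
  have "(\<Sum>j<length bs. bs ! j / (1 + \<sigma> - xs ! j)) =
      (\<Sum>l = 2..L. (\<mu> l - m l) / (\<sigma> + \<theta> / \<theta>1 l)) + (\<Sum>l = 1..L. m l / (\<sigma> + \<theta> / \<theta>2 l))"
    unfolding sum_nth_conv_sum_list[OF len, of "\<lambda>b x. b / (1 + \<sigma> - x)"]
    unfolding bs_def xs_def set2[symmetric]
    by (simp add: sum.distinct_set_conv_list map2_map del: upt_Suc set_upt)
  then show "(c - sum_list bs) / (1 + \<sigma>) + (\<Sum>j<length bs. bs ! j / (1 + \<sigma> - xs ! j)) =
      (\<Sum>l = 1..L. (\<mu> l - m l) / (\<sigma> + \<theta> / \<theta>1 l) + m l / (\<sigma> + \<theta> / \<theta>2 l))"
    unfolding c sum.distrib by (simp add: set1 one add.commute add.assoc)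
qed

text \<open>Putting s = \<sigma>/\<theta> makes s + 1/t = (\<sigma> + \<theta>/t)/\<theta>. Each
  transform then contributes \<theta>^(\<mu> l) and the logarithmic derivative one more \<theta>, in
  total \<theta>^(c + 1). The factor sqrt(pi \<theta>) of the square root formula takes away
  \<theta>^(1/2), and its sqrt pi cancels \<Gamma>(1/2).\<close>

lemma (in prob_space) kms_power_sqrt_sum:
  fixes X :: "nat \<Rightarrow> 'a \<Rightarrow> real" and \<kappa> \<mu> m \<theta>1 \<theta>2 :: "nat \<Rightarrow> real" and L :: nat
  assumes L: "L \<ge> 1" and indep: "indep_vars (\<lambda>_. borel) X {1..L}"
    and X: "\<And>l. l \<in> {1..L} \<Longrightarrow> kms_power M (\<kappa> l) (\<mu> l) (m l) (X l)"
    and \<theta>1: "\<And>l. l \<in> {1..L} \<Longrightarrow> \<theta>1 l = theta1 (\<kappa> l) (\<mu> l)"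
    and \<theta>2: "\<And>l. l \<in> {1..L} \<Longrightarrow> \<theta>2 l = theta2 (\<kappa> l) (\<mu> l) (m l)"
  defines "c \<equiv> \<Sum>l = 1..L. \<mu> l"
  defines "bs \<equiv> map (\<lambda>l. \<mu> l - m l) [2..<L+1] @ map m [1..<L+1]"
    and "xs \<equiv> map (\<lambda>l. 1 - \<theta>1 1 / \<theta>1 l) [2..<L+1] @ map (\<lambda>l. 1 - \<theta>1 1 / \<theta>2 l) [1..<L+1]"
  shows "integrable M (\<lambda>\<omega>. sqrt (\<Sum>l = 1..L. X l \<omega>))"
    and "(\<integral>\<omega>. sqrt (\<Sum>l = 1..L. X l \<omega>) \<partial>M) =
      (\<Prod>l = 1..L. \<theta>1 l powr (m l - \<mu> l) * \<theta>2 l powr (- m l)) * \<theta>1 1 powr (c + 1/2) *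
      (Gamma (c + 1/2) / Gamma c) * lauricella_FD (c + 1/2) bs c xs"
proof -
  define \<theta> where "\<theta> = \<theta>1 1"
  define S where "S \<omega> = (\<Sum>l = 1..L. X l \<omega>)" for \<omega>
  define K where "K = (\<Prod>l = 1..L. \<theta>1 l powr (m l - \<mu> l) * \<theta>2 l powr (- m l))"
  have par: "\<kappa> l > 0 \<and> \<mu> l > 0 \<and> m l > 0" if "l \<in> {1..L}" for l
    using X[OF that] by (simp add: kms_power_def)
  have pos: "\<theta>1 l > 0 \<and> \<theta>2 l > 0" if "l \<in> {1..L}" for l
    using theta_pos[of "\<kappa> l" "\<mu> l" "m l"] par[OF that] \<theta>1[OF that] \<theta>2[OF that] by simp
  have \<theta>: "\<theta> > 0" using pos[of 1] L by (simp add: \<theta>_def)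
  have c: "c > 0" unfolding c_def using par L by (intro sum_pos) auto
  have K: "K \<ge> 0" unfolding K_def by (intro prod_nonneg) auto
  have S_meas [measurable]: "S \<in> borel_measurable M"
    unfolding S_def[abs_def] using kms_power_measurable[OF X] by (intro borel_measurable_sum) auto
  have "AE \<omega> in M. \<forall>l\<in>{1..L}. X l \<omega> > 0"
    by (intro AE_finite_allI kms_power_AE_pos[OF X]) auto
  then have S0: "AE \<omega> in M. 0 \<le> S \<omega>"
    unfolding S_def by eventually_elim (intro sum_nonneg, auto intro: less_imp_le)
  define \<Phi> where "\<Phi> \<sigma> = (\<Prod>l = 1..L. (\<sigma> + \<theta> / \<theta>1 l) powr (m l - \<mu> l) * (\<sigma> + \<theta> / \<theta>2 l) powr (- m l))" for \<sigma>
  define D where "D \<sigma> = (\<Sum>l = 1..L. (\<mu> l - m l) / (\<sigma> + \<theta> / \<theta>1 l) + m l / (\<sigma> + \<theta> / \<theta>2 l))" for \<sigma>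
  have scale: "\<sigma> / \<theta> + 1 / t = (\<sigma> + \<theta> / t) / \<theta>" if "t > 0" for \<sigma> t
    using that \<theta> by (simp add: field_simps)
  have \<Phi>D: "(\<integral>\<^sup>+\<omega>. ennreal (S \<omega> * exp (- (\<sigma> / \<theta>) * S \<omega>)) \<partial>M) = ennreal (K * \<theta> powr (c + 1) * (\<Phi> \<sigma> * D \<sigma>))"
    "0 \<le> D \<sigma>"
    if \<sigma>: "\<sigma> > 0" for \<sigma>
  proof -
    define \<phi> where "\<phi> l = \<theta>1 l powr (m l - \<mu> l) * \<theta>2 l powr (- m l) *
        ((\<sigma> / \<theta> + 1 / \<theta>1 l) powr (m l - \<mu> l) * (\<sigma> / \<theta> + 1 / \<theta>2 l) powr (- m l))" for l
    define d where "d l = (\<mu> l - m l) / (\<sigma> / \<theta> + 1 / \<theta>1 l) + m l / (\<sigma> / \<theta> + 1 / \<theta>2 l)" for l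
    have s: "\<sigma> / \<theta> \<ge> 0" using \<sigma> \<theta> by simp
    have int: "(\<integral>\<^sup>+\<omega>. ennreal (S \<omega> * exp (- (\<sigma> / \<theta>) * S \<omega>)) \<partial>M) = ennreal (prod \<phi> {1..L} * sum d {1..L})"
      unfolding S_def
      by (rule nn_integral_sum_exp_kms_power[OF _ indep X s]) (auto simp: \<phi>_def d_def \<theta>1 \<theta>2)
    have "\<phi> l = \<theta>1 l powr (m l - \<mu> l) * \<theta>2 l powr (- m l) *
        (\<theta> powr \<mu> l * ((\<sigma> + \<theta> / \<theta>1 l) powr (m l - \<mu> l) * (\<sigma> + \<theta> / \<theta>2 l) powr (- m l)))"
      if l: "l \<in> {1..L}" for l
    proof -
      have "\<sigma> + \<theta> / \<theta>1 l > 0" "\<sigma> + \<theta> / \<theta>2 l > 0" using pos[OF l] \<theta> \<sigma> by (auto intro!: add_pos_pos)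
      then show ?thesis
        unfolding \<phi>_def scale[OF pos[OF l, THEN conjunct1]] scale[OF pos[OF l, THEN conjunct2]]
        using \<theta> by (simp add: powr_divide powr_minus powr_diff field_simps)
    qed
    then have "prod \<phi> {1..L} = K * (\<theta> powr c * \<Phi> \<sigma>)"
      using \<theta> by (simp add: prod.distrib K_def \<Phi>_def c_def powr_sum)
    moreover have "d l = \<theta> * ((\<mu> l - m l) / (\<sigma> + \<theta> / \<theta>1 l) + m l / (\<sigma> + \<theta> / \<theta>2 l))"
      if l: "l \<in> {1..L}" for l
      unfolding d_def scale[OF pos[OF l, THEN conjunct1]] scale[OF pos[OF l, THEN conjunct2]]
      using \<theta> by (simp add: field_simps)
    then have d_sum: "sum d {1..L} = \<theta> * D \<sigma>"
      by (simp add: D_def sum_distrib_left)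
    ultimately show "(\<integral>\<^sup>+\<omega>. ennreal (S \<omega> * exp (- (\<sigma> / \<theta>) * S \<omega>)) \<partial>M) = ennreal (K * \<theta> powr (c + 1) * (\<Phi> \<sigma> * D \<sigma>))"
      using int \<theta> by (simp add: powr_add mult_ac)
    have "0 \<le> d l" if "l \<in> {1..L}" for l
      using kms_power_laplace(3)[OF X[OF that] s] that by (simp add: d_def \<theta>1 \<theta>2)
    then have "0 \<le> \<theta> * D \<sigma>" unfolding d_sum[symmetric] by (intro sum_nonneg) auto
    then show "0 \<le> D \<sigma>" using \<theta> by (simp add: zero_le_mult_iff)
  qed
  have \<Phi>0: "0 \<le> \<Phi> \<sigma>" for \<sigma> unfolding \<Phi>_def by (intro prod_nonneg) auto
  define F where "F = lauricella_FD (c + 1/2) bs c xs"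
  define f where "f \<sigma> = (1 + \<sigma>) powr (- (c - sum_list bs)) * (\<Prod>j<length bs. (1 + \<sigma> - xs ! j) powr (- bs ! j)) *
      ((c - sum_list bs) / (1 + \<sigma>) + (\<Sum>j<length bs. bs ! j / (1 + \<sigma> - xs ! j)))" for \<sigma>
  have f: "f \<sigma> = \<Phi> \<sigma> * D \<sigma>" if "\<sigma> > 0" for \<sigma>
    using interferer_lists_prod_sum[where \<mu> = \<mu> and m = m and ?\<theta>1.0 = \<theta>1 and ?\<theta>2.0 = \<theta>2, OF L pos that] unfolding f_def \<Phi>_def D_def bs_def xs_def c_def \<theta>_def by simp
  have xs: "length xs = length bs" "\<And>t. t \<in> set xs \<Longrightarrow> t < 1"
    using pos \<theta> L by (auto simp: xs_def bs_def \<theta>_def)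
  \<comment> \<open>The Lauricella integral is used with \<alpha> = 1/2, the exponent in the square
    root formula; this is the origin of the first parameter c + 1/2.\<close>
  have half: "c + 1 - 1 / 2 = c + 1 / 2" by simp
  have "(\<integral>\<^sup>+\<sigma>. ennreal (indicator {0<..} \<sigma> * (\<sigma> powr (1 / 2 - 1) * f \<sigma>)) \<partial>lborel) =
      ennreal (Gamma (1 / 2) * Gamma (c + 1 / 2) / Gamma c * F)" and F: "0 \<le> F"
    using nn_integral_lauricella_FD[of "1/2" c xs bs, OF _ _ c xs] c f \<Phi>D(2) \<Phi>0
    by (simp_all only: half f_def[symmetric] F_def[symmetric]) auto
  note f_int = this(1)
  have "ennreal (sqrt (pi * \<theta>)) * (\<integral>\<^sup>+\<omega>. ennreal (sqrt (S \<omega>)) \<partial>M) =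
    (\<integral>\<^sup>+\<sigma>. ennreal (K * \<theta> powr (c + 1)) * ennreal (indicator {0<..} \<sigma> * (\<sigma> powr (1 / 2 - 1) * f \<sigma>)) \<partial>lborel)"
    unfolding nn_integral_sqrt_via_exp[OF S_meas S0 \<theta>]
  proof (intro nn_integral_cong)
    fix \<sigma> :: real
    show "ennreal (indicator {0<..} \<sigma> * \<sigma> powr (1 / 2 - 1)) *
       (\<integral>\<^sup>+\<omega>. ennreal (S \<omega> * exp (- (\<sigma> / \<theta>) * S \<omega>)) \<partial>M) =
      ennreal (K * \<theta> powr (c + 1)) * ennreal (indicator {0<..} \<sigma> * (\<sigma> powr (1 / 2 - 1) * f \<sigma>))"
    proof (cases "\<sigma> > 0")
      case True
      then show ?thesis
        using \<Phi>D[OF True] \<Phi>0[of \<sigma>] K by (simp add: f mult_ac flip: ennreal_mult)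
    qed simp
  qed
  also have "\<dots> = ennreal (K * \<theta> powr (c + 1)) * ennreal (Gamma (1 / 2) * Gamma (c + 1 / 2) / Gamma c * F)"
  proof -
    have "f \<in> borel_measurable borel" unfolding f_def[abs_def] by measurable
    then show ?thesis by (subst nn_integral_cmult, simp, simp only: f_int)
  qed
  also have "\<dots> = ennreal (K * \<theta> powr (c + 1) * (Gamma (1 / 2) * Gamma (c + 1 / 2) / Gamma c * F))"
    by (rule ennreal_mult'[symmetric]) (use K in simp)
  also have "K * \<theta> powr (c + 1) * (Gamma (1 / 2) * Gamma (c + 1 / 2) / Gamma c * F) =
      sqrt (pi * \<theta>) * (K * \<theta> powr (c + 1/2) * (Gamma (c + 1/2) / Gamma c) * F)"
  proof -
    have "\<theta> powr (c + 1) = \<theta> powr (c + 1/2) * sqrt \<theta>"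
      using \<theta> by (simp add: powr_half_sqrt[symmetric] add.commute flip: powr_add)
    then show ?thesis by (simp add: Gamma_one_half_real real_sqrt_mult)
  qed
  also have "ennreal \<dots> = ennreal (sqrt (pi * \<theta>)) * ennreal (K * \<theta> powr (c + 1/2) * (Gamma (c + 1/2) / Gamma c) * F)"
    by (rule ennreal_mult') (use \<theta> in simp)
  finally have "(\<integral>\<^sup>+\<omega>. ennreal (sqrt (S \<omega>)) \<partial>M) = ennreal (K * \<theta> powr (c + 1/2) * (Gamma (c + 1/2) / Gamma c) * F)"
    using \<theta> by (simp only: ennreal_mult_cancel_left) simp
  \<comment> \<open>A nonnegative real value lets one \<open>ennreal\<close> identity yield
    integrability and the integral together; the sign of \<open>F\<close> is needed for
    this.\<close>
  moreover have val: "0 \<le> K * \<theta> powr (c + 1/2) * (Gamma (c + 1/2) / Gamma c) * F"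
    using c by (intro mult_nonneg_nonneg divide_nonneg_pos K F less_imp_le[OF Gamma_real_pos] Gamma_real_pos) auto
  ultimately have "integrable M (\<lambda>\<omega>. sqrt (S \<omega>)) \<and>
      (\<integral>\<omega>. sqrt (S \<omega>) \<partial>M) = K * \<theta> powr (c + 1/2) * (Gamma (c + 1/2) / Gamma c) * F"
    using S0 val by (subst (asm) nn_integral_eq_integrable) auto
  then show "integrable M (\<lambda>\<omega>. sqrt (\<Sum>l = 1..L. X l \<omega>))"
    and "(\<integral>\<omega>. sqrt (\<Sum>l = 1..L. X l \<omega>) \<partial>M) =
      (\<Prod>l = 1..L. \<theta>1 l powr (m l - \<mu> l) * \<theta>2 l powr (- m l)) * \<theta>1 1 powr (c + 1/2) *
      (Gamma (c + 1/2) / Gamma c) * lauricella_FD (c + 1/2) bs c xs"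
    by (simp_all add: S_def K_def F_def \<theta>_def)
qed

text \<open>The moment formula at q = \<mu> - 1/2 and s = 0, where \<mu> > 1/2 says that x^(\<mu> -
  3/2) is integrable at 0. The argument of the Gauss function is 1 - \<theta>1/\<theta>2, and
  \<theta>1/\<theta>2 = m/(m + \<mu> \<kappa>).\<close>

lemma kms_power_inverse_sqrt:
  assumes X: "kms_power P \<kappa> \<mu> m X" and \<mu>: "\<mu> > 1/2"
  defines "\<theta>1 \<equiv> theta1 \<kappa> \<mu>" and "\<theta>2 \<equiv> theta2 \<kappa> \<mu> m"
  shows "integrable P (\<lambda>\<omega>. 1 / sqrt (X \<omega>))"
    and "(\<integral>\<omega>. 1 / sqrt (X \<omega>) \<partial>P) = \<theta>1 powr (m - \<mu>) * \<theta>2 powr (- m) * \<theta>1 powr (\<mu> - 1/2) *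
      (Gamma (\<mu> - 1/2) / Gamma \<mu>) * hyp2F1 (\<mu> - 1/2) m \<mu> (\<mu> * \<kappa> / (m + \<mu> * \<kappa>))"
proof -
  have par: "\<kappa> > 0" "\<mu> > 0" "m > 0" using X by (auto simp: kms_power_def)
  have \<theta>: "\<theta>1 > 0" "\<theta>2 > 0" using theta_pos[OF par] by (auto simp: \<theta>1_def \<theta>2_def)
  define z where "z = \<mu> * \<kappa> / (m + \<mu> * \<kappa>)"
  define v where "v = \<theta>1 powr (m - \<mu>) * \<theta>2 powr (- m) * \<theta>1 powr (\<mu> - 1/2) *
      (Gamma (\<mu> - 1/2) / Gamma \<mu>) * hyp2F1 (\<mu> - 1/2) m \<mu> z"
  have den: "m + \<mu> * \<kappa> > 0" using par by (simp add: add_pos_pos)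
  have \<theta>2: "\<theta>2 = \<theta>1 * ((m + \<mu> * \<kappa>) / m)"
    by (simp add: \<theta>1_def \<theta>2_def theta1_def theta2_def add.commute)
  have "\<theta>1 / \<theta>2 = m / (m + \<mu> * \<kappa>)"
    unfolding \<theta>2 using \<theta>(1) by simp
  moreover have "(1 / \<theta>1 - 1 / \<theta>2) / (1 / \<theta>1) = 1 - \<theta>1 / \<theta>2"
    using \<theta> by (simp add: field_simps)
  ultimately have z: "(1 / \<theta>1 - 1 / \<theta>2) / (1 / \<theta>1) = z"
    using den by (simp add: z_def field_simps)
  have z01: "0 \<le> z" "z < 1" using par den by (auto simp: z_def)
  have h: "1 / sqrt x = x powr (\<mu> - 1/2 - \<mu>) * exp (- 0 * x)" if "x > 0" for x
  proof -
    have "\<mu> - 1/2 - \<mu> = - (1/2)" by simp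
    then have "x powr (\<mu> - 1/2 - \<mu>) = 1 / x powr (1/2)" by (simp only: powr_minus_divide)
    then show ?thesis using that by (simp add: powr_half_sqrt)
  qed
  have "(\<integral>\<^sup>+\<omega>. ennreal (1 / sqrt (X \<omega>)) \<partial>P) =
    ennreal (\<theta>1 powr (m - \<mu>) * \<theta>2 powr (- m) * (Gamma (\<mu> - 1/2) / Gamma \<mu> * (0 + 1 / \<theta>1) powr (- (\<mu> - 1/2)) *
      hyp2F1 (\<mu> - 1/2) m \<mu> ((1 / \<theta>1 - 1 / \<theta>2) / (0 + 1 / \<theta>1))))"
    unfolding \<theta>1_def \<theta>2_def
    by (rule kms_power_moment[OF X, where h = "\<lambda>x. 1 / sqrt x"]) (use \<mu> h in simp_all)
  also have "\<dots> = ennreal v"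
  proof -
    have "(0 + 1 / \<theta>1) powr (- (\<mu> - 1/2)) = \<theta>1 powr (\<mu> - 1/2)"
      using \<theta> by (simp add: powr_divide powr_minus_divide powr_diff)
    then show ?thesis unfolding v_def using z by (simp only: add_0_left mult_ac)
  qed
  finally have int: "(\<integral>\<^sup>+\<omega>. ennreal (1 / sqrt (X \<omega>)) \<partial>P) = ennreal v" .
  have "0 \<le> v"
    unfolding v_def using \<mu> par z01
    by (intro mult_nonneg_nonneg divide_nonneg_pos hyp2F1_nonneg less_imp_le[OF Gamma_real_pos] Gamma_real_pos) auto
  moreover have "AE \<omega> in P. 0 \<le> 1 / sqrt (X \<omega>)"
    using kms_power_AE_pos[OF X] by eventually_elim simp
  moreover have "(\<lambda>\<omega>. 1 / sqrt (X \<omega>)) \<in> borel_measurable P"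
    using kms_power_measurable[OF X] by measurable
  ultimately have "integrable P (\<lambda>\<omega>. 1 / sqrt (X \<omega>)) \<and> (\<integral>\<omega>. 1 / sqrt (X \<omega>) \<partial>P) = v"
    using int by (subst (asm) nn_integral_eq_integrable) auto
  then show "integrable P (\<lambda>\<omega>. 1 / sqrt (X \<omega>))"
    and "(\<integral>\<omega>. 1 / sqrt (X \<omega>) \<partial>P) = \<theta>1 powr (m - \<mu>) * \<theta>2 powr (- m) * \<theta>1 powr (\<mu> - 1/2) *
      (Gamma (\<mu> - 1/2) / Gamma \<mu>) * hyp2F1 (\<mu> - 1/2) m \<mu> (\<mu> * \<kappa> / (m + \<mu> * \<kappa>))"
    by (simp_all add: v_def z_def)
qed

text \<open>Integrability is asserted along with the value because the Bochner integral of a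
  non-integrable function is 0 by convention, so the equation alone would not say that the mean
  exists.\<close>

theorem theorem1:
  fixes P :: "'a measure"
    and gd :: "'a \<Rightarrow> real" and g :: "nat \<Rightarrow> 'a \<Rightarrow> real"
    and L :: nat
    and \<kappa> \<mu> m :: real and \<kappa>i \<mu>i mi :: "nat \<Rightarrow> real"
    and \<theta>1 \<theta>2 M :: real and \<theta>1i \<theta>2i :: "nat \<Rightarrow> real"
  assumes "prob_space P"
    and "L \<ge> 1"
    and "prob_space.indep_vars P (\<lambda>_. borel) (\<lambda>l. if l = 0 then gd else g l) {0..L}"
    and "kms_power P \<kappa> \<mu> m gd"
    and "\<And>l. l \<in> {1..L} \<Longrightarrow> kms_power P (\<kappa>i l) (\<mu>i l) (mi l) (g l)"
    and "\<mu> > 1/2"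
    and "\<theta>1 = theta1 \<kappa> \<mu>" and "\<theta>2 = theta2 \<kappa> \<mu> m"
    and "\<And>l. l \<in> {1..L} \<Longrightarrow> \<theta>1i l = theta1 (\<kappa>i l) (\<mu>i l)"
    and "\<And>l. l \<in> {1..L} \<Longrightarrow> \<theta>2i l = theta2 (\<kappa>i l) (\<mu>i l) (mi l)"
    and "M = (\<Sum>l = 1..L. \<mu>i l)"
  shows "integrable P (evm_ratio L gd g) \<and>
    EVM P L gd g =
      (\<Prod>l = 1..L. \<theta>1i l powr (mi l - \<mu>i l) * \<theta>2i l powr (- mi l)) *
      \<theta>1 powr (m - \<mu>) * \<theta>2 powr (- m) * \<theta>1 powr (\<mu> - 1/2) *
      hyp2F1 (\<mu> - 1/2) m \<mu> (\<mu> * \<kappa> / (m + \<mu> * \<kappa>)) *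
      \<theta>1i 1 powr (M + 1/2) *
      (Gamma (\<mu> - 1/2) * Gamma (M + 1/2) / (Gamma \<mu> * Gamma M)) *
      lauricella_FD (M + 1/2)
        (map (\<lambda>l. \<mu>i l - mi l) [2..<L+1] @ map mi [1..<L+1])
        M
        (map (\<lambda>l. 1 - \<theta>1i 1 / \<theta>1i l) [2..<L+1] @ map (\<lambda>l. 1 - \<theta>1i 1 / \<theta>2i l) [1..<L+1])"
proof -
  interpret prob_space P by fact
  \<comment> \<open>Index 0 carries the desired signal, so one independent family covers all
    variables; summing the indices 1 to L gives a variable independent of index 0.\<close>
  define X where "X l = (if l = 0 then gd else g l)" for l :: nat
  define S where "S \<omega> = (\<Sum>l = 1..L. g l \<omega>)" for \<omega>
  have X: "(\<Sum>l = 1..L. X l \<omega>) = S \<omega>" for \<omega>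
    by (simp add: X_def S_def)
  have indep: "indep_vars (\<lambda>_. borel) X (insert 0 {1..L})"
  proof -
    have "insert 0 {1..L} = {0..L}" by auto
    with assms(3) show ?thesis by (simp only: X_def[abs_def])
  qed
  have kms: "kms_power P (\<kappa>i l) (\<mu>i l) (mi l) (X l)" if "l \<in> {1..L}" for l
    using assms(5)[OF that] that by (simp add: X_def)
  note sqrt_sum = kms_power_sqrt_sum[where \<kappa> = \<kappa>i and \<mu> = \<mu>i and m = mi and ?\<theta>1.0 = \<theta>1i and ?\<theta>2.0 = \<theta>2i, OF assms(2) indep_vars_subset[OF indep subset_insertI] kms assms(9,10)]
  have S: "integrable P (\<lambda>\<omega>. sqrt (S \<omega>))"
    "(\<integral>\<omega>. sqrt (S \<omega>) \<partial>P) =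
      (\<Prod>l = 1..L. \<theta>1i l powr (mi l - \<mu>i l) * \<theta>2i l powr (- mi l)) * \<theta>1i 1 powr (M + 1/2) *
      (Gamma (M + 1/2) / Gamma M) * lauricella_FD (M + 1/2)
        (map (\<lambda>l. \<mu>i l - mi l) [2..<L+1] @ map mi [1..<L+1]) M
        (map (\<lambda>l. 1 - \<theta>1i 1 / \<theta>1i l) [2..<L+1] @ map (\<lambda>l. 1 - \<theta>1i 1 / \<theta>2i l) [1..<L+1])"
    using sqrt_sum unfolding X assms(11) by blast+
  note G = kms_power_inverse_sqrt[OF assms(4,6), folded assms(7,8)]
  have "indep_var borel gd borel S"
    using indep_vars_sum[OF _ _ indep] by (simp add: X_def S_def[abs_def])
  then have "indep_var borel ((\<lambda>x. 1 / sqrt x) \<circ> gd) borel (sqrt \<circ> S)"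
    by (rule indep_var_compose) auto
  then have ind: "indep_var borel (\<lambda>\<omega>. 1 / sqrt (gd \<omega>)) borel (\<lambda>\<omega>. sqrt (S \<omega>))"
    by (simp add: o_def)
  \<comment> \<open>The real \<open>sqrt\<close> is odd and hence multiplicative on all reals, so
    this holds pointwise, also off the almost sure event where the powers are positive.\<close>
  have ratio: "evm_ratio L gd g = (\<lambda>\<omega>. 1 / sqrt (gd \<omega>) * sqrt (S \<omega>))"
    by (simp add: fun_eq_iff evm_ratio_def S_def real_sqrt_divide)
  have factors: "a * b * t * (v / w) * h * (k * t' * (v' / w') * F) = k * a * b * t * h * t' * (v * v' / (w * w')) * F"
    for a b t v w h k t' v' w' F :: real
    by simp
  show ?thesis
  proof (rule conjI)
    show "integrable P (evm_ratio L gd g)"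
      unfolding ratio by (rule indep_var_integrable[OF ind G(1) S(1)])
    show "EVM P L gd g = (\<Prod>l = 1..L. \<theta>1i l powr (mi l - \<mu>i l) * \<theta>2i l powr (- mi l)) *
      \<theta>1 powr (m - \<mu>) * \<theta>2 powr (- m) * \<theta>1 powr (\<mu> - 1/2) *
      hyp2F1 (\<mu> - 1/2) m \<mu> (\<mu> * \<kappa> / (m + \<mu> * \<kappa>)) * \<theta>1i 1 powr (M + 1/2) *
      (Gamma (\<mu> - 1/2) * Gamma (M + 1/2) / (Gamma \<mu> * Gamma M)) *
      lauricella_FD (M + 1/2)
        (map (\<lambda>l. \<mu>i l - mi l) [2..<L+1] @ map mi [1..<L+1])
        M
        (map (\<lambda>l. 1 - \<theta>1i 1 / \<theta>1i l) [2..<L+1] @ map (\<lambda>l. 1 - \<theta>1i 1 / \<theta>2i l) [1..<L+1])"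
    proof -
      have "EVM P L gd g = (\<integral>\<omega>. 1 / sqrt (gd \<omega>) \<partial>P) * (\<integral>\<omega>. sqrt (S \<omega>) \<partial>P)"
        unfolding EVM_def ratio by (rule indep_var_lebesgue_integral[OF ind G(1) S(1)])
      then show ?thesis unfolding G(2) S(2) by (simp only: factors)
    qed
  qed
qed

end
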